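(* Let $\mathcal{A}$ and $\mathcal{B}$ be two factor von Neumann algebras. Suppose that $\phi:\mathcal{A}\to\mathcal{B}$ is a bijective map (not assumed linear) with $$\phi([A,B]_{*}\bullet C)=[\phi(A),\phi(B)]_{*}\bullet\phi(C)\quad\text{for all } A,B,C\in\mathcal{A}.$$ Then $\phi$ is a linear $*$-isomorphism, or a conjugate linear $*$-isomorphism, or the negative of a linear $*$-isomorphism, or the negative of a conjugate linear $*$-isomorphism.
   Context: Algebras and spaces are over $\mathbb{C}$. A von Neumann algebra is a weakly closed, self-adjoint algebra of operators on a Hilbert space containing the identity operator $I$; it is a factor if its center contains only the scalar operators. For elements $X,Y$ of a $*$-algebra, $[X,Y]_{*}=XY-YX^{*}$ and $X\bullet Y=XY+YX^{*}$, so that $[A,B]_{*}\bullet C=(AB-BA^{*})C+C(AB-BA^{*})^{*}$. A linear (respectively conjugate linear) $*$-isomorphism is a bijective linear (respectively conjugate linear) map $\psi$ with $\psi(AB)=\psi(A)\psi(B)$ and $\psi(A^{*})=\psi(A)^{*}$ for all $A,B$.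
   Formalization: The factor A is additionally assumed not to consist of scalar operators only (dimension at least 2), since for A = B = the complex numbers the non-additive bijection x+iy ↦ x³+4iy³ preserves the product and refutes the claim. *)

theory Defs
  imports "HOL-Analysis.Analysis"
begin

section \<open>Complex Hilbert spaces\<close>

class complex_vector = real_vector +
  fixes scaleC :: "complex \<Rightarrow> 'a \<Rightarrow> 'a" (infixr "*\<^sub>C" 75)
  assumes scaleC_add_right: "c *\<^sub>C (x + y) = c *\<^sub>C x + c *\<^sub>C y"
    and scaleC_add_left: "(c + d) *\<^sub>C x = c *\<^sub>C x + d *\<^sub>C x"
    and scaleC_scaleC: "c *\<^sub>C (d *\<^sub>C x) = (c * d) *\<^sub>C x"
    and scaleC_one: "1 *\<^sub>C x = x"
    and scaleR_scaleC: "r *\<^sub>R x = complex_of_real r *\<^sub>C x"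

text \<open>The inner product is linear in the first argument. Completeness comes from
  the class \<^class>\<open>banach\<close>. The zero space is not excluded.\<close>

class complex_hilbert = complex_vector + banach +
  fixes cinner :: "'a \<Rightarrow> 'a \<Rightarrow> complex"
  assumes cinner_commute: "cinner x y = cnj (cinner y x)"
    and cinner_add_left: "cinner (x + y) z = cinner x z + cinner y z"
    and cinner_scaleC_left: "cinner (c *\<^sub>C x) y = c * cinner x y"
    and cinner_ge_zero: "0 \<le> Re (cinner x x)"
    and cinner_eq_zero_iff: "cinner x x = 0 \<longleftrightarrow> x = 0"
    and norm_eq_sqrt_cinner: "norm x = sqrt (Re (cinner x x))"


section \<open>Bounded complex-linear operators\<close>

typedef (overloaded) ('h::complex_hilbert) bop =
  "{T :: 'h \<Rightarrow>\<^sub>L 'h. \<forall>c x. blinfun_apply T (c *\<^sub>C x) = c *\<^sub>C blinfun_apply T x}"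
  morphisms blinfun_of_bop bop_of_blinfun
  by (rule exI[of _ 0]) (simp, metis add_cancel_right_left scaleC_add_right)

setup_lifting type_definition_bop

lift_definition bop_apply :: "'h::complex_hilbert bop \<Rightarrow> 'h \<Rightarrow> 'h" is blinfun_apply .

lemma bop_eqI: "(\<And>x. bop_apply S x = bop_apply T x) \<Longrightarrow> S = T"
  by transfer (rule blinfun_eqI)

lemma bop_apply_scaleC: "bop_apply T (c *\<^sub>C x) = c *\<^sub>C bop_apply T x"
  by transfer simp

lemma scaleC_zero_right: "c *\<^sub>C 0 = (0 :: 'a::complex_vector)"
  by (metis add_cancel_right_left scaleC_add_right)

lemma scaleC_minus_right: "c *\<^sub>C (- x) = - (c *\<^sub>C x)" for x :: "'a::complex_vector"
  by (metis add.right_inverse add_eq_0_iff scaleC_add_right scaleC_zero_right)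

lemma scaleC_diff_right: "c *\<^sub>C (x - y) = c *\<^sub>C x - c *\<^sub>C y" for x :: "'a::complex_vector"
  using scaleC_add_right[of c x "- y"] by (simp add: scaleC_minus_right)

lemma bounded_linear_scaleC: "bounded_linear ((*\<^sub>C) c :: 'h::complex_hilbert \<Rightarrow> 'h)"
proof (rule bounded_linear_intro[where K = "cmod c"])
  fix x y :: 'h and r :: real
  show "c *\<^sub>C (x + y) = c *\<^sub>C x + c *\<^sub>C y" by (rule scaleC_add_right)
  show "c *\<^sub>C (r *\<^sub>R x) = r *\<^sub>R (c *\<^sub>C x)"
    by (simp add: scaleR_scaleC scaleC_scaleC mult.commute)
  have "cinner (c *\<^sub>C x) (c *\<^sub>C x) = c * cnj c * cinner x x"
    by (metis cinner_commute cinner_scaleC_left complex_cnj_mult mult.assoc)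
  then have "cinner (c *\<^sub>C x) (c *\<^sub>C x) = complex_of_real ((cmod c)\<^sup>2) * cinner x x"
    by (simp only: complex_norm_square)
  then have "Re (cinner (c *\<^sub>C x) (c *\<^sub>C x)) = (cmod c)\<^sup>2 * Re (cinner x x)"
    by (simp only: Re_complex_of_real Im_complex_of_real times_complex.sel mult_zero_left diff_zero)
  then show "norm (c *\<^sub>C x) \<le> norm x * cmod c"
    by (simp add: norm_eq_sqrt_cinner real_sqrt_mult mult.commute)
qed

instantiation bop :: (complex_hilbert) "{ring, monoid_mult, complex_vector}"
begin

lift_definition zero_bop :: "'a bop" is 0 by (simp add: scaleC_zero_right)
lift_definition plus_bop :: "'a bop \<Rightarrow> 'a bop \<Rightarrow> 'a bop" is "(+)"
  by (simp add: blinfun.add_left scaleC_add_right)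
lift_definition uminus_bop :: "'a bop \<Rightarrow> 'a bop" is uminus
  by (simp add: blinfun.minus_left scaleC_minus_right)
lift_definition minus_bop :: "'a bop \<Rightarrow> 'a bop \<Rightarrow> 'a bop" is "(-)"
  by (simp add: blinfun.diff_left scaleC_diff_right)
lift_definition one_bop :: "'a bop" is id_blinfun by simp
lift_definition times_bop :: "'a bop \<Rightarrow> 'a bop \<Rightarrow> 'a bop" is "(o\<^sub>L)" by simp
lift_definition scaleR_bop :: "real \<Rightarrow> 'a bop \<Rightarrow> 'a bop" is "(*\<^sub>R)"
  by (simp add: blinfun.scaleR_left scaleR_scaleC scaleC_scaleC mult.commute)
lift_definition scaleC_bop :: "complex \<Rightarrow> 'a bop \<Rightarrow> 'a bop"
  is "\<lambda>c T. Blinfun ((*\<^sub>C) c) o\<^sub>L T"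
  by (simp add: bounded_linear_Blinfun_apply bounded_linear_scaleC scaleC_scaleC mult.commute)

lemma bop_apply_simps:
  "bop_apply (0 :: 'a bop) x = 0"
  "bop_apply (S + T :: 'a bop) x = bop_apply S x + bop_apply T x"
  "bop_apply (- T :: 'a bop) x = - bop_apply T x"
  "bop_apply (S - T :: 'a bop) x = bop_apply S x - bop_apply T x"
  "bop_apply (1 :: 'a bop) x = x"
  "bop_apply (S * T :: 'a bop) x = bop_apply S (bop_apply T x)"
  "bop_apply (r *\<^sub>R T :: 'a bop) x = r *\<^sub>R bop_apply T x"
  "bop_apply (c *\<^sub>C T :: 'a bop) x = c *\<^sub>C bop_apply T x"
  by (transfer; simp add: blinfun.bilinear_simps bounded_linear_Blinfun_apply
      bounded_linear_scaleC)+

instance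
proof
  have add: "bop_apply T (x + y) = bop_apply T x + bop_apply T y" for T :: "'a bop" and x y
    by transfer (simp add: blinfun.add_right)
  fix S T U :: "'a bop" and c d :: complex and r s :: real
  show "S + T + U = S + (T + U)" "S + T = T + S" "0 + S = S" "- S + S = 0" "S - T = S + - T"
    "S * T * U = S * (T * U)" "(S + T) * U = S * U + T * U" "S * (T + U) = S * T + S * U"
    "1 * S = S" "S * 1 = S"
    "r *\<^sub>R (S + T) = r *\<^sub>R S + r *\<^sub>R T" "(r + s) *\<^sub>R S = r *\<^sub>R S + s *\<^sub>R S"
    "r *\<^sub>R s *\<^sub>R S = (r * s) *\<^sub>R S" "1 *\<^sub>R S = S"
    "c *\<^sub>C (S + T) = c *\<^sub>C S + c *\<^sub>C T" "(c + d) *\<^sub>C S = c *\<^sub>C S + d *\<^sub>C S"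
    "c *\<^sub>C d *\<^sub>C S = (c * d) *\<^sub>C S" "1 *\<^sub>C S = S" "r *\<^sub>R S = complex_of_real r *\<^sub>C S"
    by (rule bop_eqI, simp add: bop_apply_simps add algebra_simps scaleC_add_right
        scaleC_add_left scaleC_scaleC scaleC_one flip: scaleR_scaleC)+
qed

end

text \<open>The adjoint exists and is unique by the Riesz representation theorem.\<close>

definition adj :: "'h::complex_hilbert bop \<Rightarrow> 'h bop" where
  "adj T = (THE S. \<forall>x y. cinner (bop_apply T x) y = cinner x (bop_apply S y))"


section \<open>Factor von Neumann algebras\<close>

text \<open>The coarsest topology for which all maps \<open>T \<mapsto> \<langle>T x, y\<rangle>\<close> are continuous: functions
  from pairs of vectors to \<^typ>\<open>complex\<close> carry the product topology.\<close>

definition weak_operator_topology :: "'h::complex_hilbert bop topology" where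
  "weak_operator_topology =
     pullback_topology UNIV (\<lambda>T (x, y). cinner (bop_apply T x) y) euclidean"

definition von_neumann_algebra :: "'h::complex_hilbert bop set \<Rightarrow> bool" where
  "von_neumann_algebra A \<longleftrightarrow>
     1 \<in> A \<and>
     (\<forall>S\<in>A. \<forall>T\<in>A. S + T \<in> A) \<and>
     (\<forall>c. \<forall>T\<in>A. c *\<^sub>C T \<in> A) \<and>
     (\<forall>S\<in>A. \<forall>T\<in>A. S * T \<in> A) \<and>
     (\<forall>T\<in>A. adj T \<in> A) \<and>
     closedin weak_operator_topology A"

text \<open>Algebras consisting of scalars only must be excluded from the domain of \<open>\<phi>\<close>: on the
  one-dimensional factor the mixed product of \<open>a, b, c\<close> is \<open>-4 (Im a) (Im b) c\<close>, and it is
  preserved by the non-additive bijection \<open>x + i y \<mapsto> x^3 + 4 i y^3\<close>.\<close>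

definition scalar_operators :: "'h::complex_hilbert bop set" where
  "scalar_operators = range (\<lambda>c. c *\<^sub>C 1)"

definition center :: "'h::complex_hilbert bop set \<Rightarrow> 'h bop set" where
  "center A = {Z \<in> A. \<forall>T\<in>A. Z * T = T * Z}"

definition factor :: "'h::complex_hilbert bop set \<Rightarrow> bool" where
  "factor A \<longleftrightarrow> von_neumann_algebra A \<and> center A \<subseteq> scalar_operators"


section \<open>Skew products and isomorphisms\<close>

definition skew_lie :: "'h::complex_hilbert bop \<Rightarrow> 'h bop \<Rightarrow> 'h bop" ("[_, _]\<^sub>*") where
  "[X, Y]\<^sub>* = X * Y - Y * adj X"

definition skew_jordan :: "'h::complex_hilbert bop \<Rightarrow> 'h bop \<Rightarrow> 'h bop" (infixl "\<bullet>\<^sub>*" 70) where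
  "X \<bullet>\<^sub>* Y = X * Y + Y * adj X"

definition linear_star_isomorphism ::
  "'h::complex_hilbert bop set \<Rightarrow> 'k::complex_hilbert bop set \<Rightarrow> ('h bop \<Rightarrow> 'k bop) \<Rightarrow> bool" where
  "linear_star_isomorphism A B \<psi> \<longleftrightarrow>
     bij_betw \<psi> A B \<and>
     (\<forall>S\<in>A. \<forall>T\<in>A. \<psi> (S + T) = \<psi> S + \<psi> T) \<and>
     (\<forall>c. \<forall>T\<in>A. \<psi> (c *\<^sub>C T) = c *\<^sub>C \<psi> T) \<and>
     (\<forall>S\<in>A. \<forall>T\<in>A. \<psi> (S * T) = \<psi> S * \<psi> T) \<and>
     (\<forall>T\<in>A. \<psi> (adj T) = adj (\<psi> T))"

definition conj_linear_star_isomorphism ::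
  "'h::complex_hilbert bop set \<Rightarrow> 'k::complex_hilbert bop set \<Rightarrow> ('h bop \<Rightarrow> 'k bop) \<Rightarrow> bool" where
  "conj_linear_star_isomorphism A B \<psi> \<longleftrightarrow>
     bij_betw \<psi> A B \<and>
     (\<forall>S\<in>A. \<forall>T\<in>A. \<psi> (S + T) = \<psi> S + \<psi> T) \<and>
     (\<forall>c. \<forall>T\<in>A. \<psi> (c *\<^sub>C T) = cnj c *\<^sub>C \<psi> T) \<and>
     (\<forall>S\<in>A. \<forall>T\<in>A. \<psi> (S * T) = \<psi> S * \<psi> T) \<and>
     (\<forall>T\<in>A. \<psi> (adj T) = adj (\<psi> T))"

end

(* The real scalars are exactly the elements that annihilate every mixed product in the first slot,
   and i in the first slot recovers the skew Lie product. Hence phi maps scalars to scalars,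
   is homogeneous up to a multiplicative function of the real scalar, and satisfies
   phi (i [B, C]_* ) = +-i [phi B, phi C]_*. It follows that phi preserves self-adjointness and, on
   self-adjoint elements, commutators and (up to a real factor) Jordan products. A Jordan
   multiplicative bijection is additive, by the Peirce decomposition for a nontrivial projection
   and primeness of the factor. Everything else follows by comparing real and imaginary parts; the
   identity B o (C o D) - C o (B o D) = [[B, C], D] forces phi 1 = +-1.

   A nontrivial projection is the kernel projection of |K| - K for a self-adjoint K that is neither
   positive nor negative; kernel projections are strong limits of powers of contractions. *)
theory Submission
  imports Defs
begin

section \<open>Hilbert space geometry\<close>

text \<open>The hypothesis speaks of products only, so sums are inaccessible at first and every
  constant must be carried as an unknown: \<open>p\<close> with \<open>f 1 = p\<close>, the
  multiplicative function \<open>m\<close> on real scalars, the factor \<open>\<eta>\<close> of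
  commutators and the factor \<open>d\<close> of Jordan products. Evaluating product identities at
  scalars ties them together; \<open>\<eta>\<close> turns out to be a sign at once, but
  \<open>p\<close> only after additivity has made \<open>m\<close> the identity. The two signs
  account for the four cases of the conclusion. Additivity is first obtained on self-adjoint
  elements alone, and splitting \<open>f (H + \<i> K)\<close> is a separate problem: commutators
  determine the image only up to a scalar, which a Jordan product with a nonscalar element then
  removes. Weak closedness enters only through pointwise limits of bounded families: sequences of
  powers and of iterates for projections, a net for primeness. That \<open>B\<close> is nonscalar is
  derived: on scalars the mixed product is symmetric in its first two slots, and this symmetry would
  pass to \<open>A\<close>.\<close>

lemma cinner_add_right: "cinner x (y + z) = cinner x y + cinner x z"
  by (metis cinner_add_left cinner_commute complex_cnj_add)

lemma cinner_scaleC_right: "cinner x (c *\<^sub>C y) = cnj c * cinner x y"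
  by (metis cinner_scaleC_left cinner_commute complex_cnj_mult)

lemma scaleC_minus1_left: "(-1) *\<^sub>C x = - (x::'a::complex_vector)"
  using scaleR_scaleC[of "-1" x] by simp

lemma scaleC_minus_left: "(- c) *\<^sub>C x = - (c *\<^sub>C x)" for x :: "'a::complex_vector"
  using scaleC_scaleC[of "-1" c x] by (simp add: scaleC_minus1_left)

lemma cinner_minus_left: "cinner (- x) y = - cinner x y"
  using cinner_scaleC_left[of "-1" x y] by (simp add: scaleC_minus1_left)

lemma cinner_minus_right: "cinner x (- y) = - cinner x y"
  using cinner_scaleC_right[of x "-1" y] by (simp add: scaleC_minus1_left)

lemma cinner_diff_left: "cinner (x - y) z = cinner x z - cinner y z"
  using cinner_add_left[of x "- y" z] by (simp add: cinner_minus_left)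

lemma cinner_diff_right: "cinner x (y - z) = cinner x y - cinner x z"
  using cinner_add_right[of x y "- z"] by (simp add: cinner_minus_right)

lemma cinner_scaleR_left: "cinner (r *\<^sub>R x) y = of_real r * cinner x y"
  by (simp add: scaleR_scaleC cinner_scaleC_left)

lemma cinner_scaleR_right: "cinner x (r *\<^sub>R y) = of_real r * cinner x y"
  by (simp add: scaleR_scaleC cinner_scaleC_right)

lemma cinner_zero_left [simp]: "cinner 0 x = 0"
  using cinner_diff_left[of 0 0 x] by simp

lemma cinner_zero_right [simp]: "cinner x 0 = 0"
  using cinner_diff_right[of x 0 0] by simp

lemmas cinner_simps = cinner_add_left cinner_add_right cinner_diff_left cinner_diff_right
  cinner_minus_left cinner_minus_right cinner_scaleC_left cinner_scaleC_right
  cinner_scaleR_left cinner_scaleR_right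

lemma cinner_self: "cinner x x = of_real ((norm x)\<^sup>2)"
proof -
  have "Im (cinner x x) = 0"
    using arg_cong[OF cinner_commute[of x x], of Im] by simp
  moreover have "(norm x)\<^sup>2 = Re (cinner x x)"
    by (simp add: norm_eq_sqrt_cinner cinner_ge_zero)
  ultimately show ?thesis by (simp add: complex_eq_iff)
qed

lemma norm_add_sq: "(norm (x + y))\<^sup>2 = (norm x)\<^sup>2 + 2 * Re (cinner x y) + (norm (y::'h::complex_hilbert))\<^sup>2"
proof -
  have "complex_of_real ((norm (x + y))\<^sup>2) = cinner (x + y) (x + y)"
    by (simp only: cinner_self)
  also have "\<dots> = cinner x x + (cinner x y + cnj (cinner x y)) + cinner y y"
    using cinner_commute[of y x] by (simp add: cinner_simps)
  finally have "Re (complex_of_real ((norm (x + y))\<^sup>2)) = Re (\<dots>)" by (rule arg_cong)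
  then show ?thesis by (simp add: cinner_self del: of_real_power)
qed

lemma norm_diff_sq: "(norm (x - y))\<^sup>2 = (norm x)\<^sup>2 - 2 * Re (cinner x y) + (norm (y::'h::complex_hilbert))\<^sup>2"
  using norm_add_sq[of x "- y"] by (simp add: cinner_minus_right)

lemma norm_scaleC: "norm (c *\<^sub>C x) = cmod c * norm (x::'h::complex_hilbert)"
proof -
  have "cinner (c *\<^sub>C x) (c *\<^sub>C x) = of_real ((cmod c)\<^sup>2) * cinner x x"
    by (simp add: cinner_simps complex_norm_square mult_ac del: of_real_power)
  then have "complex_of_real ((norm (c *\<^sub>C x))\<^sup>2) = of_real ((cmod c * norm x)\<^sup>2)"
    by (simp add: cinner_self power_mult_distrib)
  then have "(norm (c *\<^sub>C x))\<^sup>2 = (cmod c * norm x)\<^sup>2"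
    by (simp only: of_real_eq_iff)
  then show ?thesis by (simp add: power2_eq_iff_nonneg)
qed

lemma Cauchy_Schwarz_cinner: "cmod (cinner x y) \<le> norm x * norm (y::'h::complex_hilbert)"
proof (cases "y = 0")
  case False
  define n where "n = (norm y)\<^sup>2"
  have n: "n > 0" using False by (simp add: n_def)
  define a where "a = cinner x y"
  \<comment> \<open>The coefficient of the orthogonal projection of \<open>x\<close> onto
    \<open>y\<close>.\<close>
  define c where "c = a / of_real n"
  have "0 \<le> (norm (x - c *\<^sub>C y))\<^sup>2" by simp
  also have "\<dots> = (norm x)\<^sup>2 - 2 * Re (cnj c * a) + (cmod c)\<^sup>2 * n"
    by (simp add: norm_diff_sq norm_scaleC cinner_simps a_def n_def power_mult_distrib)
  also have "cnj c * a = of_real ((cmod a)\<^sup>2 / n)"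
    by (simp add: c_def complex_norm_square mult.commute del: of_real_power)
  also have "(cmod c)\<^sup>2 * n = (cmod a)\<^sup>2 / n"
    using n by (simp add: c_def norm_divide power_divide power2_eq_square)
  finally have "(cmod a)\<^sup>2 / n \<le> (norm x)\<^sup>2" by simp
  then have "(cmod a)\<^sup>2 \<le> (norm x * norm y)\<^sup>2"
    using n by (simp add: divide_le_eq n_def power_mult_distrib)
  then show ?thesis unfolding a_def by (rule power2_le_imp_le) simp
qed simp

lemma bounded_bilinear_cinner:
  "bounded_bilinear (cinner :: 'h::complex_hilbert \<Rightarrow> 'h \<Rightarrow> complex)"
proof
  show "\<exists>K. \<forall>a b::'h. norm (cinner a b) \<le> norm a * norm b * K"
    by (rule exI[of _ 1]) (simp add: Cauchy_Schwarz_cinner)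
qed (simp_all add: cinner_simps scaleR_conv_of_real)

lemmas tendsto_cinner [tendsto_intros] = bounded_bilinear.tendsto[OF bounded_bilinear_cinner]

lemma cinner_eqI:
  assumes "\<And>z. cinner z x = cinner z y"
  shows "x = y"
proof -
  have "cinner (x - y) (x - y) = 0"
    using assms[of "x - y"] by (simp add: cinner_diff_right)
  then show ?thesis by (simp add: cinner_eq_zero_iff)
qed

text \<open>The representing vector minimises the strictly convex functional
  \<open>\<lambda>x. \<parallel>x\<parallel>\<^sup>2 - 2 Re (f x)\<close>.\<close>

lemma riesz_representation:
  fixes f :: "'h::complex_hilbert \<Rightarrow> complex"
  assumes add: "\<And>x y. f (x + y) = f x + f y"
    and scale: "\<And>c x. f (c *\<^sub>C x) = c * f x"
    and bound: "\<And>x. cmod (f x) \<le> K * norm x"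
  shows "\<exists>z. \<forall>x. f x = cinner x z"
proof -
  have scaleR: "f (r *\<^sub>R x) = of_real r * f x" for r x
    by (simp add: scaleR_scaleC scale)
  have blf: "bounded_linear f"
    by (rule bounded_linear_intro[where K = K])
      (auto simp: add scaleR scaleR_conv_of_real mult.commute[of _ K] bound)
  define J where "J x = (norm x)\<^sup>2 - 2 * Re (f x)" for x
  have lower: "- K\<^sup>2 \<le> J x" for x
  proof -
    have "Re (f x) \<le> K * norm x"
      using bound[of x] abs_Re_le_cmod[of "f x"] by linarith
    moreover have "0 \<le> (norm x - K)\<^sup>2" by simp
    then have "2 * (K * norm x) \<le> (norm x)\<^sup>2 + K\<^sup>2"
      by (simp add: power2_diff mult_ac)
    ultimately show ?thesis by (simp add: J_def)
  qed
  define m where "m = Inf (range J)"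
  have bdd: "bdd_below (range J)"
    by (rule bdd_belowI[of _ "- K\<^sup>2"]) (use lower in auto)
  have m_le: "m \<le> J x" for x unfolding m_def by (rule cInf_lower[OF _ bdd]) simp
  have "\<exists>x. J x < m + 1 / real (Suc n)" for n
    using cInf_lessD[of "range J" "m + 1 / real (Suc n)"] by (auto simp: m_def)
  then obtain X where X: "\<And>n. J (X n) < m + 1 / real (Suc n)" by metis
  \<comment> \<open>The parallelogram law: the linear terms of \<open>J\<close> cancel, so two
    near-minimisers are close because \<open>J\<close> at their midpoint is at least
    \<open>m\<close>.\<close>
  have para: "(norm (x - y))\<^sup>2 = 2 * J x + 2 * J y - 4 * J ((1/2) *\<^sub>R (x + y))" for x y
  proof -
    have "J ((1/2) *\<^sub>R (x + y)) = (norm (x + y))\<^sup>2 / 4 - (Re (f x) + Re (f y))"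
      by (simp only: J_def scaleR add norm_scaleR power_mult_distrib) (simp add: power2_eq_square field_simps)
    then show ?thesis by (simp add: J_def norm_add_sq norm_diff_sq field_simps)
  qed
  have dist: "(norm (X i - X j))\<^sup>2 \<le> 2 * (1 / real (Suc i)) + 2 * (1 / real (Suc j))" for i j
    using para[of "X i" "X j"] X[of i] X[of j] m_le[of "(1/2) *\<^sub>R (X i + X j)"]
    by linarith
  have "Cauchy X"
  proof (rule CauchyI)
    fix e :: real assume e: "0 < e"
    then obtain M where M: "inverse (real (Suc M)) < e\<^sup>2 / 4"
      using reals_Archimedean[of "e\<^sup>2 / 4"] by auto
    have "norm (X i - X j) < e" if "M \<le> i" "M \<le> j" for i j
    proof -
      have "1 / real (Suc i) \<le> 1 / real (Suc M)" "1 / real (Suc j) \<le> 1 / real (Suc M)"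
        using that by (simp_all add: frac_le)
      then have "(norm (X i - X j))\<^sup>2 < e\<^sup>2"
        using dist[of i j] M unfolding inverse_eq_divide by linarith
      then show ?thesis using e by (simp add: power2_less_imp_less)
    qed
    then show "\<exists>M. \<forall>i\<ge>M. \<forall>j\<ge>M. norm (X i - X j) < e" by blast
  qed
  then obtain z where z: "X \<longlonglongrightarrow> z" using Cauchy_convergent_iff convergent_def by blast
  have Jz: "J z \<le> m"
  proof (rule LIMSEQ_le)
    show "(\<lambda>n. J (X n)) \<longlonglongrightarrow> J z"
      unfolding J_def by (intro tendsto_intros z bounded_linear.tendsto[OF blf z])
    show "(\<lambda>n. m + 1 / real (Suc n)) \<longlonglongrightarrow> m"
      using tendsto_add[OF tendsto_const LIMSEQ_Suc[OF lim_1_over_n], of m] by simp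
    show "\<exists>N. \<forall>n\<ge>N. J (X n) \<le> m + 1 / real (Suc n)" using X less_imp_le by blast
  qed
  \<comment> \<open>First variation at the minimiser \<open>z\<close> in the direction
    \<open>h\<close>. The \<open>+ 1\<close> in \<open>N\<close> below keeps the step
    \<open>- g / N\<close> defined for \<open>h = 0\<close>.\<close>
  have Re_eq: "Re (f h) = Re (cinner h z)" for h
  proof -
    define g where "g = Re (cinner h z) - Re (f h)"
    have *: "0 \<le> t\<^sup>2 * (norm h)\<^sup>2 + 2 * t * g" for t
    proof -
      have "J z \<le> J (z + t *\<^sub>R h)" using Jz m_le order_trans by blast
      moreover have "Re (cinner z h) = Re (cinner h z)" by (metis cinner_commute complex_cnj(1) complex.sel(1) complex.collapse)
      ultimately show ?thesis
        by (simp add: J_def norm_add_sq add scaleR g_def cinner_simps power_mult_distrib algebra_simps)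
    qed
    show ?thesis
    proof (rule ccontr)
      assume "Re (f h) \<noteq> Re (cinner h z)"
      then have g: "g \<noteq> 0" by (simp add: g_def)
      define N where "N = (norm h)\<^sup>2 + 1"
      have N: "N > 0" by (simp add: N_def add_nonneg_pos)
      have "0 \<le> (g / N)\<^sup>2 * (norm h)\<^sup>2 + 2 * (- g / N) * g" using *[of "- g / N"] by simp
      also have "\<dots> \<le> (g / N)\<^sup>2 * N + 2 * (- g / N) * g"
        by (intro add_right_mono mult_left_mono) (auto simp: N_def)
      also have "\<dots> = - (g\<^sup>2 / N)" using N by (simp add: field_simps power2_eq_square)
      also have "\<dots> < 0" using g N by simp
      finally show False by simp
    qed
  qed
  have "f x = cinner x z" for x
  proof (rule complex_eqI)
    show "Re (f x) = Re (cinner x z)" by (rule Re_eq)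
    show "Im (f x) = Im (cinner x z)"
      using Re_eq[of "\<i> *\<^sub>C x"] by (simp add: scale cinner_scaleC_left)
  qed
  then show ?thesis by blast
qed


section \<open>Bounded operators and adjoints\<close>

lemma bop_apply_add: "bop_apply T (x + y) = bop_apply T x + bop_apply T y"
  by transfer (simp add: blinfun.add_right)

lemma bop_apply_diff: "bop_apply T (x - y) = bop_apply T x - bop_apply T y"
  by transfer (simp add: blinfun.diff_right)

lemma bop_apply_zero [simp]: "bop_apply T 0 = 0"
  using bop_apply_diff[of T 0 0] by simp

lemma bop_bounded: "\<exists>K\<ge>0. \<forall>x. norm (bop_apply T x) \<le> K * norm x"
  by transfer (metis norm_blinfun norm_ge_zero)

lemma bounded_linear_bop: "bounded_linear (bop_apply T)"
  by transfer (simp add: blinfun.bounded_linear_right)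

lemmas tendsto_bop = bounded_linear.tendsto[OF bounded_linear_bop]

lemma bop_exists:
  fixes g :: "'h::complex_hilbert \<Rightarrow> 'h"
  assumes add: "\<And>x y. g (x + y) = g x + g y"
    and scale: "\<And>c x. g (c *\<^sub>C x) = c *\<^sub>C g x"
    and bound: "\<And>x. norm (g x) \<le> K * norm x"
  shows "\<exists>T. bop_apply T = g"
proof -
  have bl: "bounded_linear g"
    by (rule bounded_linear_intro[where K = K])
      (auto simp: add scale scaleR_scaleC mult.commute[of _ K] bound)
  then have "bop_apply (bop_of_blinfun (Blinfun g)) = g"
    by (simp add: bop_apply.rep_eq bop_of_blinfun_inverse scale bounded_linear_Blinfun_apply)
  then show ?thesis ..
qed

lemma adjoint_exists: "\<exists>S. \<forall>x y. cinner (bop_apply T x) y = cinner x (bop_apply S y)"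
proof -
  obtain K where K: "K \<ge> 0" "\<And>x. norm (bop_apply T x) \<le> K * norm x"
    using bop_bounded by blast
  have "\<exists>z. \<forall>x. cinner (bop_apply T x) y = cinner x z" for y
  proof (rule riesz_representation[where K = "K * norm y"])
    show "cmod (cinner (bop_apply T x) y) \<le> K * norm y * norm x" for x
      using Cauchy_Schwarz_cinner[of "bop_apply T x" y] mult_right_mono[OF K(2)[of x], of "norm y"]
      by (simp add: mult_ac)
  qed (simp_all add: bop_apply_add bop_apply_scaleC cinner_simps)
  then obtain g where g: "\<And>x y. cinner (bop_apply T x) y = cinner x (g y)" by metis
  have "\<exists>S. bop_apply S = g"
  proof (rule bop_exists[where K = K])
    show "g (x + y) = g x + g y" for x y
      by (rule cinner_eqI) (simp add: cinner_simps flip: g)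
    show "g (c *\<^sub>C x) = c *\<^sub>C g x" for c x
      by (rule cinner_eqI) (simp add: cinner_simps flip: g)
    show "norm (g y) \<le> K * norm y" for y
    proof (cases "g y = 0")
      case False
      \<comment> \<open>Testing the defining identity at \<open>x = g y\<close> bounds
        \<open>g\<close> by the same constant as \<open>T\<close>.\<close>
      have "(norm (g y))\<^sup>2 = cmod (cinner (bop_apply T (g y)) y)"
        by (simp add: g cinner_self norm_power)
      also have "\<dots> \<le> (K * norm y) * norm (g y)"
        using Cauchy_Schwarz_cinner[of "bop_apply T (g y)" y]
          mult_right_mono[OF K(2)[of "g y"], of "norm y"] by (simp add: mult_ac)
      finally show ?thesis using False by (simp add: power2_eq_square)
    qed (simp add: K)
  qed
  then show ?thesis using g by auto
qed

lemma adj_eqI: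
  assumes "\<And>x y. cinner (bop_apply T x) y = cinner x (bop_apply S y)"
  shows "adj T = S"
  unfolding adj_def
proof (rule the_equality)
  fix U assume "\<forall>x y. cinner (bop_apply T x) y = cinner x (bop_apply U y)"
  then show "U = S" by (metis bop_eqI cinner_eqI assms)
qed (use assms in blast)

lemma cinner_adj_right: "cinner x (bop_apply (adj T) y) = cinner (bop_apply T x) y"
  using adjoint_exists[of T] adj_eqI by metis

lemma cinner_adj_left: "cinner (bop_apply (adj T) x) y = cinner x (bop_apply T y)"
  by (metis cinner_adj_right cinner_commute)

lemma adj_adj [simp]: "adj (adj T) = T"
  by (rule adj_eqI) (simp add: cinner_adj_left)

lemma adj_add: "adj (S + T) = adj S + adj T"
  by (rule adj_eqI) (simp add: bop_apply_simps cinner_simps cinner_adj_right)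

lemma adj_diff: "adj (S - T) = adj S - adj T"
  by (rule adj_eqI) (simp add: bop_apply_simps cinner_simps cinner_adj_right)

lemma adj_minus: "adj (- T) = - adj T"
  by (rule adj_eqI) (simp add: bop_apply_simps cinner_simps cinner_adj_right)

lemma adj_mult: "adj (S * T) = adj T * adj S"
  by (rule adj_eqI) (simp add: bop_apply_simps cinner_adj_right)

lemma adj_scaleC: "adj (c *\<^sub>C T) = cnj c *\<^sub>C adj T"
  by (rule adj_eqI) (simp add: bop_apply_simps cinner_simps cinner_adj_right)

lemma adj_one [simp]: "adj 1 = 1"
  by (rule adj_eqI) (simp add: bop_apply_simps)

lemma adj_zero [simp]: "adj 0 = 0"
  by (rule adj_eqI) (simp add: bop_apply_simps)

lemma scaleC_mult_left: "(c *\<^sub>C S) * T = c *\<^sub>C (S * T)" for S T :: "'h::complex_hilbert bop"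
  by (rule bop_eqI) (simp add: bop_apply_simps)

lemma scaleC_mult_right: "S * (c *\<^sub>C T) = c *\<^sub>C (S * T)" for S T :: "'h::complex_hilbert bop"
  by (rule bop_eqI) (simp add: bop_apply_simps bop_apply_scaleC)

lemma scaleC_zero_left [simp]: "0 *\<^sub>C x = (0::'a::complex_vector)"
  using scaleR_scaleC[of 0 x] by simp

lemma scaleC_eq_0_iff: "c *\<^sub>C x = 0 \<longleftrightarrow> c = 0 \<or> x = (0::'a::complex_vector)"
proof (cases "c = 0")
  case False
  then have "x = inverse c *\<^sub>C c *\<^sub>C x" by (simp add: scaleC_scaleC scaleC_one)
  then show ?thesis by (metis scaleC_zero_right False)
qed simp

section \<open>Von Neumann algebras\<close>

text \<open>Formulated for filters, since \<open>factor_prime\<close> takes a limit along the finite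
  subsets of the algebra. The topology is pulled back from a product of copies of the complex plane,
  so convergence of all matrix coefficients is convergence in it.\<close>

lemma wot_closed_limit:
  assumes A: "closedin weak_operator_topology A" and F: "F \<noteq> bot"
    and T: "\<And>i. T i \<in> A"
    and lim: "\<And>x y. ((\<lambda>i. cinner (bop_apply (T i) x) y) \<longlongrightarrow> cinner (bop_apply S x) y) F"
  shows "S \<in> A"
proof -
  define w :: "'a bop \<Rightarrow> 'a \<times> 'a \<Rightarrow> complex" where "w = (\<lambda>T (x, y). cinner (bop_apply T x) y)"
  have "openin weak_operator_topology (- A)"
    using openin_diff[OF openin_topspace A]
    by (simp add: weak_operator_topology_def topspace_pullback_topology Compl_eq_Diff_UNIV)
  then obtain U where U: "open U" "- A = w -` U"
    by (auto simp: weak_operator_topology_def openin_pullback_topology w_def)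
  have "limitin (product_topology (\<lambda>_. euclidean) UNIV) (\<lambda>i. w (T i)) (w S) F"
    using lim by (auto simp: limitin_componentwise w_def)
  then have "((\<lambda>i. w (T i)) \<longlongrightarrow> w S) F"
    by (simp add: euclidean_product_topology)
  then have "w S \<in> U \<Longrightarrow> \<forall>\<^sub>F i in F. w (T i) \<in> U"
    using U(1) by (simp add: tendsto_def)
  moreover have "w (T i) \<notin> U" for i using U(2) T by auto
  ultimately have "w S \<notin> U" using F by auto
  then show ?thesis using U(2) by auto
qed

text \<open>Linearity and the bound \<open>K\<close> pass to the pointwise limit, so it is an
  operator; strong convergence gives convergence of matrix coefficients, hence membership.\<close>

lemma strong_limit_exists:
  assumes A: "closedin weak_operator_topology A" and F: "F \<noteq> bot"
    and T: "\<And>i. T i \<in> A" and bound: "\<And>i x. norm (bop_apply (T i) x) \<le> K * norm x"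
    and lim: "\<And>x. ((\<lambda>i. bop_apply (T i) x) \<longlongrightarrow> g x) F"
  shows "\<exists>S\<in>A. bop_apply S = g"
proof -
  have "g (x + y) = g x + g y" for x y
    using tendsto_unique[OF F lim[of "x + y"]] tendsto_add[OF lim[of x] lim[of y]]
    by (simp add: bop_apply_add)
  moreover have "g (c *\<^sub>C x) = c *\<^sub>C g x" for c x
    using tendsto_unique[OF F lim[of "c *\<^sub>C x"]]
      bounded_linear.tendsto[OF bounded_linear_scaleC lim[of x]]
    by (simp add: bop_apply_scaleC)
  moreover have "norm (g x) \<le> K * norm x" for x
    using tendsto_upperbound[OF tendsto_norm[OF lim[of x]] _ F] bound by simp
  ultimately obtain S where S: "bop_apply S = g" using bop_exists by blast
  have "S \<in> A"
    by (rule wot_closed_limit[OF A F T]) (auto simp: S intro!: tendsto_intros lim)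
  with S show ?thesis by blast
qed

section \<open>Kernel projections inside a von Neumann algebra\<close>

locale von_neumann =
  fixes A :: "'h::complex_hilbert bop set"
  assumes von_neumann_algebra: "von_neumann_algebra A"
begin

lemma one_in [simp, intro]: "1 \<in> A"
  and add_in [simp, intro]: "S \<in> A \<Longrightarrow> T \<in> A \<Longrightarrow> S + T \<in> A"
  and scaleC_in [simp, intro]: "T \<in> A \<Longrightarrow> c *\<^sub>C T \<in> A"
  and mult_in [simp, intro]: "S \<in> A \<Longrightarrow> T \<in> A \<Longrightarrow> S * T \<in> A"
  and adj_in [simp, intro]: "T \<in> A \<Longrightarrow> adj T \<in> A"
  and wot_closed: "closedin weak_operator_topology A"
  using von_neumann_algebra unfolding von_neumann_algebra_def by blast+

lemma zero_in [simp, intro]: "0 \<in> A"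
  using scaleC_in[OF one_in, of 0] by simp

lemma minus_in [simp, intro]: "T \<in> A \<Longrightarrow> - T \<in> A"
  using scaleC_in[of T "-1"] by (simp add: scaleC_minus1_left)

lemma diff_in [simp, intro]: "S \<in> A \<Longrightarrow> T \<in> A \<Longrightarrow> S - T \<in> A"
  using add_in[of S "- T"] by simp

lemma power_in: "T \<in> A \<Longrightarrow> T ^ n \<in> A"
  by (induction n) auto

lemma sum_in: "(\<And>i. i \<in> I \<Longrightarrow> T i \<in> A) \<Longrightarrow> sum T I \<in> A"
  by (induction I rule: infinite_finite_induct) auto

text \<open>Even powers of a self-adjoint contraction converge strongly to the projection onto the
  fixed space of its square; odd powers would oscillate where \<open>S\<close> acts as -1. With
  \<open>b x n\<close> the squared norm of \<open>S ^ n\<close> at \<open>x\<close>,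
  self-adjointness turns inner products of even powers into values of the single decreasing sequence
  \<open>b x\<close>.\<close>

lemma fixed_projection:
  assumes S: "S \<in> A" "adj S = S" and contr: "\<And>x. norm (bop_apply S x) \<le> norm x"
  shows "\<exists>E\<in>A. adj E = E \<and> S * (S * E) = E \<and>
           (\<forall>x. bop_apply S (bop_apply S x) = x \<longrightarrow> bop_apply E x = x)"
proof -
  define p where "p n = bop_apply (S ^ n)" for n
  have p_Suc: "p (Suc n) x = bop_apply S (p n x)" for n x
    by (simp add: p_def bop_apply_simps)
  have p_0: "p 0 x = x" for x by (simp add: p_def bop_apply_simps)
  have S_sa: "cinner (bop_apply S x) y = cinner x (bop_apply S y)" for x y
    by (metis S(2) cinner_adj_left)
  have p_Suc': "p (Suc n) x = p n (bop_apply S x)" for n x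
    by (simp only: p_def power_Suc2 bop_apply_simps)
  have p_sa: "cinner (p n x) y = cinner x (p n y)" for n x y
    by (induction n arbitrary: y) (simp add: p_0, metis p_Suc p_Suc' S_sa)
  have p_add: "p (m + n) x = p m (p n x)" for m n x
    by (simp add: p_def power_add bop_apply_simps)
  have p_contr: "norm (p n x) \<le> norm x" for n x
    by (induction n) (auto simp: p_0 p_Suc intro: order_trans[OF contr])
  define b where "b x n = (norm (p n x))\<^sup>2" for x n
  have "decseq (b x)" for x
    unfolding decseq_Suc_iff b_def p_Suc by (simp add: contr power_mono)
  moreover have "0 \<le> b x n" for x n by (simp add: b_def)
  ultimately have conv_b: "convergent (b x)" for x
    by (metis decseq_convergent convergent_def)
  have p_inner: "cinner (p m x) (p n x) = cinner (p (m + n) x) x" for m n x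
    by (metis add.commute p_add p_sa)
  have b_inner: "Re (cinner (p (2 * m) x) (p (2 * n) x)) = b x (m + n)" for m n x
  proof -
    have "cinner (p (2 * m) x) (p (2 * n) x) = cinner (p (m + n) x) (p (m + n) x)"
      unfolding p_inner by (simp add: mult_2 add_ac)
    then show ?thesis by (simp add: cinner_self b_def)
  qed
  \<comment> \<open>The coefficients 1, -2, 1 sum to zero, so convergence of \<open>b x\<close>
    makes the even powers Cauchy; their absolute values sum to 4, hence the tolerance
    \<open>e\<^sup>2 / 4\<close> below.\<close>
  have norm_diff: "(norm (p (2 * m) x - p (2 * n) x))\<^sup>2 = b x (2 * m) - 2 * b x (m + n) + b x (2 * n)" for m n x
    by (simp only: norm_diff_sq b_inner) (simp add: b_def)
  have "Cauchy (\<lambda>n. p (2 * n) x)" for x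
  proof (rule CauchyI)
    fix e :: real assume e: "0 < e"
    obtain l where "b x \<longlonglongrightarrow> l" using conv_b convergent_def by blast
    then obtain M where M: "\<And>n. n \<ge> M \<Longrightarrow> \<bar>b x n - l\<bar> < e\<^sup>2 / 4"
      using e by (metis LIMSEQ_iff real_norm_def zero_less_divide_iff zero_less_numeral zero_less_power)
    have "norm (p (2 * m) x - p (2 * n) x) < e" if "M \<le> m" "M \<le> n" for m n
    proof -
      have "(norm (p (2 * m) x - p (2 * n) x))\<^sup>2 < e\<^sup>2"
        using norm_diff[of m x n] M[of "2 * m"] M[of "2 * n"] M[of "m + n"] that by linarith
      then show ?thesis using e by (simp add: power2_less_imp_less)
    qed
    then show "\<exists>M. \<forall>m\<ge>M. \<forall>n\<ge>M. norm (p (2 * m) x - p (2 * n) x) < e" by blast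
  qed
  then have "\<exists>z. (\<lambda>n. p (2 * n) x) \<longlonglongrightarrow> z" for x
    using Cauchy_convergent_iff convergent_def by blast
  then obtain g where g: "\<And>x. (\<lambda>n. p (2 * n) x) \<longlonglongrightarrow> g x" by metis
  have "\<exists>E\<in>A. bop_apply E = g"
    by (rule strong_limit_exists[OF wot_closed, where T = "\<lambda>n. S ^ (2 * n)" and K = 1 and F = sequentially])
      (use p_contr g S in \<open>auto simp: p_def power_in\<close>)
  then obtain E where E: "E \<in> A" "bop_apply E = g" by blast
  have "cinner (g x) y = cinner x (g y)" for x y
    using LIMSEQ_unique[OF tendsto_cinner[OF g tendsto_const, of x y]]
      tendsto_cinner[OF tendsto_const g, of x y] by (simp add: p_sa)
  then have "adj E = E" by (intro adj_eqI) (simp add: E)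
  moreover have "bop_apply S (bop_apply S (g x)) = g x" for x
  proof -
    have "(\<lambda>n. p (2 * Suc n) x) \<longlonglongrightarrow> bop_apply S (bop_apply S (g x))"
      by (simp add: p_Suc) (intro tendsto_bop g)
    then show ?thesis using LIMSEQ_unique LIMSEQ_Suc[OF g] by blast
  qed
  then have "S * (S * E) = E" by (intro bop_eqI) (simp add: bop_apply_simps E)
  moreover have "g x = x" if "bop_apply S (bop_apply S x) = x" for x
  proof -
    have "p (2 * n) x = x" for n by (induction n) (simp_all add: p_0 p_Suc that)
    then show ?thesis using LIMSEQ_unique[OF g[of x]] by simp
  qed
  ultimately show ?thesis using E by auto
qed

text \<open>Apply \<open>fixed_projection\<close> to \<open>S = 1 - T\<close>, where
  \<open>T\<close> is \<open>c\<close> times \<open>adj Z * Z\<close> and \<open>c\<close> is small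
  enough to make \<open>T\<close> and \<open>S\<close> contractions. A vector fixed by
  \<open>S * S\<close> satisfies \<open>T (T y) = 2 T y\<close>, which a contraction allows only if
  \<open>T y = 0\<close>, and then \<open>Z y = 0\<close>.\<close>

lemma kernel_projection:
  assumes Z: "Z \<in> A"
  shows "\<exists>E\<in>A. adj E = E \<and> Z * E = 0 \<and> (\<forall>x. bop_apply Z x = 0 \<longrightarrow> bop_apply E x = x)"
proof -
  obtain K where K: "K \<ge> 0" "\<And>x. norm (bop_apply (adj Z) x) \<le> K * norm x"
    using bop_bounded by blast
  define c where "c = 1 / (K\<^sup>2 + 1)"
  have c: "c > 0" "c * K\<^sup>2 \<le> 1" by (auto simp: c_def add_nonneg_pos divide_le_eq)
  define T where "T = of_real c *\<^sub>C (adj Z * Z)"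
  have T_inner: "cinner (bop_apply T x) x = of_real (c * (norm (bop_apply Z x))\<^sup>2)" for x
    by (simp add: T_def bop_apply_simps cinner_simps cinner_adj_left cinner_self)
  have T_sa: "adj T = T" by (simp add: T_def adj_scaleC adj_mult)
  have T_sq: "(norm (bop_apply T x))\<^sup>2 \<le> c * (norm (bop_apply Z x))\<^sup>2" for x
  proof -
    have "norm (bop_apply T x) \<le> c * (K * norm (bop_apply Z x))"
      using c(1) K(2)[of "bop_apply Z x"] by (simp add: T_def bop_apply_simps norm_scaleC)
    then have "(norm (bop_apply T x))\<^sup>2 \<le> (c * (K * norm (bop_apply Z x)))\<^sup>2"
      by (rule power_mono) simp
    also have "\<dots> = (c * K\<^sup>2) * (c * (norm (bop_apply Z x))\<^sup>2)"
      by (simp add: power_mult_distrib) (simp add: power2_eq_square)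
    also have "\<dots> \<le> 1 * (c * (norm (bop_apply Z x))\<^sup>2)"
      by (rule mult_right_mono) (use c in auto)
    finally show ?thesis by simp
  qed
  have T_contr: "norm (bop_apply T x) \<le> norm x" for x
  proof (cases "bop_apply T x = 0")
    case False
    have "(norm (bop_apply T x))\<^sup>2 \<le> cmod (cinner (bop_apply T x) x)"
      using T_sq[of x] c(1) by (simp add: T_inner norm_mult norm_power)
    also have "\<dots> \<le> norm (bop_apply T x) * norm x" by (rule Cauchy_Schwarz_cinner)
    finally show ?thesis using False by (simp add: power2_eq_square)
  qed simp
  define S where "S = 1 - T"
  have S_apply: "bop_apply S x = x - bop_apply T x" for x by (simp add: S_def bop_apply_simps)
  have S_contr: "norm (bop_apply S x) \<le> norm x" for x
  proof (rule power2_le_imp_le)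
    have "cinner x (bop_apply T x) = of_real (c * (norm (bop_apply Z x))\<^sup>2)"
      using T_inner T_sa by (metis cinner_adj_right)
    then have "(norm (bop_apply S x))\<^sup>2 =
        (norm x)\<^sup>2 - 2 * (c * (norm (bop_apply Z x))\<^sup>2) + (norm (bop_apply T x))\<^sup>2"
      by (simp add: S_apply norm_diff_sq del: of_real_mult of_real_power)
    then show "(norm (bop_apply S x))\<^sup>2 \<le> (norm x)\<^sup>2"
      using T_sq[of x] c(1) zero_le_power2[of "norm (bop_apply T x)"] by linarith
  qed simp
  have "S \<in> A" "adj S = S" using Z by (simp_all add: S_def T_def adj_diff T_sa[unfolded T_def])
  from fixed_projection[OF this S_contr] obtain E where E: "E \<in> A" "adj E = E" "S * (S * E) = E"
    "\<And>x. bop_apply S (bop_apply S x) = x \<Longrightarrow> bop_apply E x = x" by blast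
  have "bop_apply Z (bop_apply E x) = 0" for x
  proof -
    define y where "y = bop_apply E x"
    have "bop_apply S (bop_apply S y) = y"
      unfolding y_def by (metis E(3) bop_apply_simps(6))
    then have "bop_apply T (bop_apply T y) = bop_apply T y + bop_apply T y"
      by (simp add: S_apply bop_apply_diff algebra_simps)
    then have "2 * norm (bop_apply T y) = norm (bop_apply T (bop_apply T y))"
      by (metis norm_scaleR scaleR_2 abs_numeral)
    also have "\<dots> \<le> norm (bop_apply T y)" by (rule T_contr)
    finally have "bop_apply T y = 0" by simp
    then have "c * (norm (bop_apply Z y))\<^sup>2 = 0"
      using T_inner[of y] by (simp add: of_real_eq_0_iff del: of_real_mult of_real_power)
    then show ?thesis using c by (simp add: y_def)
  qed
  then have "Z * E = 0" by (intro bop_eqI) (simp add: bop_apply_simps)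
  moreover have "bop_apply E x = x" if "bop_apply Z x = 0" for x
    by (rule E(4)) (simp add: S_apply T_def bop_apply_simps that scaleC_zero_right)
  ultimately show ?thesis using E by blast
qed

text \<open>One operator suffices: the quadratic form of the sum of \<open>adj (Z i) * Z i\<close>
  is the sum of the squared norms of \<open>Z i x\<close>, so its kernel is the joint
  kernel.\<close>

lemma joint_kernel_projection:
  assumes I: "finite I" and Z: "\<And>i. i \<in> I \<Longrightarrow> Z i \<in> A"
  shows "\<exists>E\<in>A. adj E = E \<and> (\<forall>i\<in>I. Z i * E = 0) \<and>
           (\<forall>x. (\<forall>i\<in>I. bop_apply (Z i) x = 0) \<longrightarrow> bop_apply E x = x)"
proof -
  define T where "T = (\<Sum>i\<in>I. adj (Z i) * Z i)"
  have T_apply: "bop_apply T x = (\<Sum>i\<in>I. bop_apply (adj (Z i)) (bop_apply (Z i) x))" for x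
    unfolding T_def using I by (induction I) (simp_all add: bop_apply_simps)
  have T_inner: "cinner (bop_apply T x) x = of_real (\<Sum>i\<in>I. (norm (bop_apply (Z i) x))\<^sup>2)" for x
    unfolding T_apply using I
    by (induction I) (simp_all add: cinner_simps cinner_adj_left cinner_self)
  have "T \<in> A" unfolding T_def by (rule sum_in) (use Z in auto)
  from kernel_projection[OF this] obtain E where E: "E \<in> A" "adj E = E" "T * E = 0"
    "\<And>x. bop_apply T x = 0 \<Longrightarrow> bop_apply E x = x" by blast
  have "Z i * E = 0" if i: "i \<in> I" for i
  proof (rule bop_eqI)
    fix x
    have "bop_apply T (bop_apply E x) = 0" by (metis E(3) bop_apply_simps(1,6))
    then have "(\<Sum>i\<in>I. (norm (bop_apply (Z i) (bop_apply E x)))\<^sup>2) = 0"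
      using T_inner[of "bop_apply E x"] by (metis cinner_zero_left of_real_eq_0_iff)
    then show "bop_apply (Z i * E) x = bop_apply 0 x"
      using I i by (simp add: sum_nonneg_eq_0_iff bop_apply_simps)
  qed
  moreover have "bop_apply E x = x" if "\<forall>i\<in>I. bop_apply (Z i) x = 0" for x
    by (rule E(4)) (simp add: T_apply that)
  ultimately show ?thesis using E by blast
qed

end

section \<open>Absolute values and nontrivial projections\<close>

context von_neumann
begin

text \<open>With \<open>X = 1 - K\<^sup>2\<close>, the iteration \<open>R \<mapsto> (X + R\<^sup>2) / 2\<close> from \<open>0\<close> converges to \<open>1 - \<bar>K\<bar>\<close>; it is
  dominated in norm by the scalar iteration \<open>r \<mapsto> (1 + r\<^sup>2) / 2\<close>, which increases to \<open>1\<close>.\<close>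

lemma absolute_value:
  assumes K: "K \<in> A" "adj K = K" and contr: "\<And>x. norm (bop_apply K x) \<le> norm x"
  shows "\<exists>Y\<in>A. adj Y = Y \<and> Y * Y = K * K \<and> Y * K = K * Y \<and> (\<forall>x. 0 \<le> Re (cinner (bop_apply Y x) x))"
proof -
  define X where "X = 1 - K * K"
  have X: "X \<in> A" "adj X = X" "X * K = K * X"
    using K by (simp_all add: X_def adj_diff adj_mult left_diff_distrib right_diff_distrib mult.assoc)
  have X_contr: "norm (bop_apply X x) \<le> norm x" for x
  proof (rule power2_le_imp_le)
    define y where "y = bop_apply K (bop_apply K x)"
    have "cinner x y = of_real ((norm (bop_apply K x))\<^sup>2)"
      unfolding y_def by (metis K(2) cinner_adj_left cinner_self)
    moreover have "(norm y)\<^sup>2 \<le> (norm (bop_apply K x))\<^sup>2"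
      unfolding y_def by (rule power_mono[OF contr]) simp
    moreover have "bop_apply X x = x - y" by (simp add: X_def y_def bop_apply_simps)
    ultimately have "(norm (bop_apply X x))\<^sup>2 = (norm x)\<^sup>2 - 2 * (norm (bop_apply K x))\<^sup>2 + (norm y)\<^sup>2"
      "(norm y)\<^sup>2 \<le> (norm (bop_apply K x))\<^sup>2"
      using norm_diff_sq[of x y] by (simp_all del: of_real_power)
    then show "(norm (bop_apply X x))\<^sup>2 \<le> (norm x)\<^sup>2"
      using zero_le_power2[of "norm (bop_apply K x)"] by linarith
  qed simp
  define R where "R = rec_nat (0::'h bop) (\<lambda>_ R. (1/2) *\<^sub>C (X + R * R))"
  define a where "a = rec_nat (0::real) (\<lambda>_ a. (1 + a\<^sup>2) / 2)"
  have R_Suc: "R (Suc n) = (1/2) *\<^sub>C (X + R n * R n)" and R_0: "R 0 = 0" for n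
    by (simp_all add: R_def)
  have a_Suc: "a (Suc n) = (1 + (a n)\<^sup>2) / 2" and a_0: "a 0 = 0" for n
    by (simp_all add: a_def)
  have a_bounds: "0 \<le> a n \<and> a n \<le> 1" for n
    by (induction n) (auto simp: a_0 a_Suc power_le_one)
  have a_mono: "a n \<le> a (Suc n)" for n
    using zero_le_power2[of "a n - 1"] by (simp add: a_Suc power2_diff)
  have R_in: "R n \<in> A" for n by (induction n) (simp_all add: R_0 R_Suc X)
  have R_sa: "adj (R n) = R n" for n
    by (induction n) (simp_all add: R_0 R_Suc X adj_scaleC adj_add adj_mult)
  \<comment> \<open>Stated for every \<open>Z\<close> commuting with \<open>X\<close>:
    \<open>Z = R m\<close> makes the iterates commute with each other, \<open>Z = K\<close> makes
    the limit commute with \<open>K\<close>.\<close>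
  have R_comm: "Z * R n = R n * Z" if Z: "Z * X = X * Z" for Z n
  proof (induction n)
    case (Suc n)
    have "Z * (R n * R n) = R n * R n * Z" by (metis Suc mult.assoc)
    with Z show ?case
      by (simp add: R_Suc scaleC_mult_left scaleC_mult_right distrib_left distrib_right)
  qed (simp add: R_0)
  have R_comm': "R m * R n = R n * R m" for m n
    using R_comm[OF R_comm[OF refl, symmetric]] by simp
  have R_norm: "norm (bop_apply (R n) x) \<le> a n * norm x" for n x
  proof (induction n arbitrary: x)
    case (Suc n)
    have "norm (bop_apply (R n) (bop_apply (R n) x)) \<le> a n * (a n * norm x)"
      by (rule order_trans[OF Suc mult_left_mono[OF Suc]]) (use a_bounds in auto)
    then have "norm (bop_apply X x + bop_apply (R n) (bop_apply (R n) x)) \<le> norm x + a n * (a n * norm x)"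
      using X_contr[of x] norm_triangle_ineq order_trans add_mono by meson
    moreover have "norm (bop_apply (R (Suc n)) x) =
        norm (bop_apply X x + bop_apply (R n) (bop_apply (R n) x)) / 2"
      by (simp add: R_Suc bop_apply_simps norm_scaleC norm_divide)
    moreover have "a (Suc n) * norm x = (norm x + a n * (a n * norm x)) / 2"
      by (simp add: a_Suc power2_eq_square distrib_right mult.assoc)
    ultimately show ?case by simp
  qed (simp add: R_0 a_0 bop_apply_simps)
  \<comment> \<open>Commuting iterates let the difference of squares factor, and the scalar sequence
    \<open>a\<close> obeys the same factorised recursion.\<close>
  have R_diff: "norm (bop_apply (R (Suc n) - R n) x) \<le> (a (Suc n) - a n) * norm x" for n x
  proof (induction n arbitrary: x)
    case 0
    show ?case using R_norm[of "Suc 0" x] by (simp add: R_0 a_0)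
  next
    case (Suc n)
    define D where "D = R (Suc n) - R n"
    define y where "y = bop_apply (R (Suc n) + R n) x"
    have "R (Suc (Suc n)) - R (Suc n) =
        (1/2) *\<^sub>C (X + R (Suc n) * R (Suc n)) - (1/2) *\<^sub>C (X + R n * R n)"
      by (simp only: R_Suc[of "Suc n"] R_Suc[of n])
    also have "\<dots> = (1/2) *\<^sub>C (R (Suc n) * R (Suc n) - R n * R n)"
      unfolding scaleC_diff_right[symmetric] by simp
    also have "R (Suc n) * R (Suc n) - R n * R n = D * (R (Suc n) + R n)"
      using R_comm'[of n "Suc n"] by (simp add: D_def left_diff_distrib distrib_left)
    finally have "R (Suc (Suc n)) - R (Suc n) = (1/2) *\<^sub>C (D * (R (Suc n) + R n))" .
    then have "norm (bop_apply (R (Suc (Suc n)) - R (Suc n)) x) = norm (bop_apply D y) / 2"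
      by (simp add: bop_apply_simps(6,8) norm_scaleC y_def norm_divide)
    moreover have "norm (bop_apply D y) \<le> (a (Suc n) - a n) * ((a (Suc n) + a n) * norm x)"
    proof (rule order_trans[OF Suc[folded D_def] mult_left_mono])
      show "norm y \<le> (a (Suc n) + a n) * norm x"
        using norm_triangle_ineq[of "bop_apply (R (Suc n)) x" "bop_apply (R n) x"]
          R_norm[of "Suc n" x] R_norm[of n x]
        by (simp add: y_def bop_apply_simps distrib_right)
    qed (use a_mono in simp)
    moreover have "2 * (a (Suc (Suc n)) - a (Suc n)) = (a (Suc n))\<^sup>2 - (a n)\<^sup>2"
    proof -
      have "2 * a (Suc k) = 1 + (a k)\<^sup>2" for k by (simp add: a_Suc)
      from this[of "Suc n"] this[of n] show ?thesis by (simp only: right_diff_distrib)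
    qed
    then have "2 * (a (Suc (Suc n)) - a (Suc n)) * norm x = (a (Suc n) - a n) * ((a (Suc n) + a n) * norm x)"
      by (simp only: power2_eq_square square_diff_square_factored) (simp only: mult_ac)
    ultimately show ?case by linarith
  qed
  have R_diff': "norm (bop_apply (R m) x - bop_apply (R n) x) \<le> (a m - a n) * norm x" if "n \<le> m" for m n x
    using that
  proof (induction m rule: dec_induct)
    case (step m)
    have "norm (bop_apply (R (Suc m)) x - bop_apply (R n) x) \<le>
        norm (bop_apply (R (Suc m)) x - bop_apply (R m) x) + norm (bop_apply (R m) x - bop_apply (R n) x)"
      by (rule norm_diff_triangle_le[OF order_refl order_refl])
    then show ?case
      using R_diff[of m x] step.IH by (simp add: bop_apply_simps left_diff_distrib)
  qed simp
  have "Cauchy a"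
  proof -
    have "incseq a" by (simp add: incseq_Suc_iff a_mono)
    then show ?thesis using a_bounds by (metis incseq_convergent convergent_def convergent_Cauchy)
  qed
  have "Cauchy (\<lambda>n. bop_apply (R n) x)" for x
  proof (rule CauchyI)
    fix e :: real assume e: "0 < e"
    define e' where "e' = e / (norm x + 1)"
    have e': "e' > 0" using e by (simp add: e'_def add_nonneg_pos)
    then obtain M where M: "\<And>m n. M \<le> m \<Longrightarrow> M \<le> n \<Longrightarrow> \<bar>a m - a n\<bar> < e'"
      using \<open>Cauchy a\<close> unfolding Cauchy_iff by (metis real_norm_def)
    have le: "norm (bop_apply (R m) x - bop_apply (R n) x) < e" if "M \<le> n" "n \<le> m" for m n
    proof -
      have "norm (bop_apply (R m) x - bop_apply (R n) x) \<le> (a m - a n) * norm x"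
        by (rule R_diff'[OF that(2)])
      also have "\<dots> \<le> e' * norm x"
        using M[of m n] that by (intro mult_right_mono) auto
      also have "\<dots> < e' * (norm x + 1)" using e' by simp
      also have "\<dots> = e" by (simp add: e'_def) (metis add_nonneg_eq_0_iff norm_ge_zero zero_neq_one zero_le_one)
      finally show ?thesis .
    qed
    have "norm (bop_apply (R m) x - bop_apply (R n) x) < e" if "M \<le> m" "M \<le> n" for m n
      using le[of n m] le[of m n] that by (cases "n \<le> m") (auto simp: norm_minus_commute)
    then show "\<exists>M. \<forall>m\<ge>M. \<forall>n\<ge>M. norm (bop_apply (R m) x - bop_apply (R n) x) < e" by blast
  qed
  then have "\<exists>z. (\<lambda>n. bop_apply (R n) x) \<longlonglongrightarrow> z" for x
    using Cauchy_convergent_iff convergent_def by blast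
  then obtain g where g: "\<And>x. (\<lambda>n. bop_apply (R n) x) \<longlonglongrightarrow> g x" by metis
  have R_contr: "norm (bop_apply (R n) x) \<le> 1 * norm x" for n x
    by (rule order_trans[OF R_norm mult_right_mono]) (use a_bounds in auto)
  have "\<exists>Q\<in>A. bop_apply Q = g"
    by (rule strong_limit_exists[OF wot_closed sequentially_bot R_in R_contr g])
  then obtain Q where Q: "Q \<in> A" "bop_apply Q = g" by blast
  have R_sa': "cinner (bop_apply (R n) x) y = cinner x (bop_apply (R n) y)" for n x y
    by (metis R_sa cinner_adj_left)
  have Q_sa': "cinner (g x) y = cinner x (g y)" for x y
  proof (rule LIMSEQ_unique)
    show "(\<lambda>n. cinner (bop_apply (R n) x) y) \<longlonglongrightarrow> cinner (g x) y" by (intro tendsto_intros g)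
    show "(\<lambda>n. cinner (bop_apply (R n) x) y) \<longlonglongrightarrow> cinner x (g y)"
      unfolding R_sa' by (intro tendsto_intros g)
  qed
  then have Q_sa: "adj Q = Q" by (intro adj_eqI) (simp add: Q)
  have "K * Q = Q * K"
  proof (rule bop_eqI)
    fix x
    have "bop_apply K (bop_apply (R n) x) = bop_apply (R n) (bop_apply K x)" for n
      using R_comm[of K n] X(3) by (metis bop_apply_simps(6))
    then have "bop_apply K (g x) = g (bop_apply K x)"
      using LIMSEQ_unique[OF tendsto_bop[OF g, of K x]] g[of "bop_apply K x"] by simp
    then show "bop_apply (K * Q) x = bop_apply (Q * K) x" by (simp add: bop_apply_simps Q)
  qed
  \<comment> \<open>In the limit of \<open>R (Suc n) + R (Suc n) = X + R n * R n\<close> one factor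
    \<open>R n\<close> is moved to the other slot of the inner product, so strong convergence of
    \<open>R n\<close> suffices for the product.\<close>
  have QQ: "X + Q * Q = Q + Q"
  proof (rule bop_eqI, rule cinner_eqI)
    fix x z
    have "(\<lambda>n. cinner z (bop_apply (R (Suc n) + R (Suc n)) x)) \<longlonglongrightarrow> cinner z (g x + g x)"
      unfolding bop_apply_simps by (intro tendsto_intros LIMSEQ_Suc[OF g])
    moreover have "R (Suc n) + R (Suc n) = X + R n * R n" for n
      unfolding R_Suc scaleC_add_left[symmetric] by (simp add: scaleC_one)
    then have "cinner z (bop_apply (R (Suc n) + R (Suc n)) x) =
        cinner z (bop_apply X x) + cinner (bop_apply (R n) z) (bop_apply (R n) x)" for n
      by (simp only: bop_apply_simps R_sa' cinner_add_right)
    moreover have "(\<lambda>n. cinner z (bop_apply X x) + cinner (bop_apply (R n) z) (bop_apply (R n) x))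
        \<longlonglongrightarrow> cinner z (bop_apply X x) + cinner (g z) (g x)"
      by (intro tendsto_intros g)
    ultimately have "cinner z (g x + g x) = cinner z (bop_apply X x) + cinner (g z) (g x)"
      using LIMSEQ_unique by simp
    then show "cinner z (bop_apply (X + Q * Q) x) = cinner z (bop_apply (Q + Q) x)"
      by (simp add: bop_apply_simps Q cinner_add_right Q_sa')
  qed
  \<comment> \<open>By \<open>QQ\<close> the square of \<open>1 - Q\<close> is \<open>1 - X\<close>,
    that is \<open>K * K\<close>; positivity holds because \<open>Q\<close> is a
    contraction.\<close>
  define Y where "Y = 1 - Q"
  have "Y * Y = 1 - (Q + Q) + Q * Q"
    by (simp add: Y_def left_diff_distrib right_diff_distrib)
  also have "\<dots> = K * K" unfolding QQ[symmetric] by (simp add: X_def)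
  finally have "Y * Y = K * K" .
  moreover have "Y \<in> A" "adj Y = Y" using Q by (simp_all add: Y_def adj_diff Q_sa)
  moreover have "Y * K = K * Y"
    using \<open>K * Q = Q * K\<close> by (simp add: Y_def left_diff_distrib right_diff_distrib)
  moreover have "0 \<le> Re (cinner (bop_apply Y x) x)" for x
  proof -
    have "norm (g x) \<le> 1 * norm x"
      using tendsto_upperbound[OF tendsto_norm[OF g[of x]], of "1 * norm x"] R_contr by simp
    then have "norm (g x) * norm x \<le> (norm x)\<^sup>2" by (simp add: power2_eq_square mult_right_mono)
    then have "Re (cinner (g x) x) \<le> (norm x)\<^sup>2"
      using Cauchy_Schwarz_cinner[of "g x" x] complex_Re_le_cmod[of "cinner (g x) x"] by linarith
    then show ?thesis by (simp add: Y_def Q bop_apply_simps cinner_simps cinner_self del: of_real_power)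
  qed
  ultimately show ?thesis by blast
qed

lemma self_adjoint_part_in:
  assumes "T \<in> A"
  obtains H K where "H \<in> A" "K \<in> A" "adj H = H" "adj K = K" "T = H + \<i> *\<^sub>C K"
proof
  let ?H = "(1/2) *\<^sub>C (T + adj T)" and ?K = "(-\<i>/2) *\<^sub>C (T - adj T)"
  show "?H \<in> A" "?K \<in> A" using assms by auto
  show "adj ?H = ?H" by (simp add: adj_scaleC adj_add add.commute)
  show "adj ?K = ?K"
    using scaleC_minus_right[of "-\<i>/2" "T - adj T"]
    by (simp add: adj_scaleC adj_diff) (metis minus_diff_eq minus_minus scaleC_minus1_left scaleC_scaleC mult_minus1_right mult_minus_left minus_divide_left)
  have "?H + \<i> *\<^sub>C ?K = (1/2) *\<^sub>C (T + T)"
    by (simp add: scaleC_scaleC scaleC_add_right[symmetric])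
  also have "\<dots> = T" unfolding scaleC_add_right scaleC_add_left[symmetric] by (simp add: scaleC_one)
  finally show "T = ?H + \<i> *\<^sub>C ?K" by simp
qed

text \<open>Polarisation at \<open>x + G x\<close>: the cross terms contribute twice the squared
  norm of \<open>G x\<close>.\<close>

lemma quadratic_form_eq_0:
  assumes "adj G = G" and "\<And>x. Re (cinner (bop_apply G x) x) = 0"
  shows "G = 0"
proof (rule bop_eqI)
  fix x
  define y where "y = bop_apply G x"
  have "cinner (bop_apply G y) x = cinner y y" by (metis assms(1) cinner_adj_left y_def)
  moreover have "Re (cinner (bop_apply G (x + y)) (x + y)) = 0" by (rule assms(2))
  ultimately have "2 * Re (cinner y y) = 0"
    using assms(2)[of x] assms(2)[of y] by (simp add: bop_apply_add cinner_simps y_def)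
  then have "norm y = 0" by (simp add: cinner_self del: of_real_power)
  then show "bop_apply G x = bop_apply 0 x" by (simp add: y_def bop_apply_simps)
qed

lemma nontrivial_projection:
  assumes nonscalar: "\<not> A \<subseteq> scalar_operators"
  shows "\<exists>P\<in>A. adj P = P \<and> P * P = P \<and> P \<noteq> 0 \<and> P \<noteq> 1"
proof -
  have "\<exists>H\<in>A. adj H = H \<and> H \<notin> scalar_operators"
  proof (rule ccontr)
    assume *: "\<not> ?thesis"
    have "T \<in> scalar_operators" if T: "T \<in> A" for T
    proof -
      obtain H K where HK: "H \<in> A" "K \<in> A" "adj H = H" "adj K = K" "T = H + \<i> *\<^sub>C K"
        using self_adjoint_part_in[OF T] .
      then obtain c d where "H = c *\<^sub>C 1" "K = d *\<^sub>C 1"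
        using * unfolding scalar_operators_def by blast
      then have "T = (c + \<i> * d) *\<^sub>C 1" by (simp add: HK scaleC_scaleC scaleC_add_left)
      then show ?thesis unfolding scalar_operators_def by blast
    qed
    then show False using nonscalar by blast
  qed
  then obtain H where H: "H \<in> A" "adj H = H" "H \<notin> scalar_operators" by blast
  define h where "h x = Re (cinner (bop_apply H x) x)" for x
  have H_eq: "H = of_real c *\<^sub>C 1" if "\<And>x. h x = c * (norm x)\<^sup>2" for c
  proof -
    have "H - of_real c *\<^sub>C 1 = 0"
      by (rule quadratic_form_eq_0)
        (use that H in \<open>auto simp: h_def adj_diff adj_scaleC bop_apply_simps cinner_simps cinner_self
          simp del: of_real_power\<close>)
    then show ?thesis by simp
  qed
  have "\<exists>x::'h. x \<noteq> 0"
  proof (rule ccontr)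
    assume "\<not> ?thesis"
    then have "x = 0" for x :: 'h by blast
    then have "H = 0 *\<^sub>C 1" by (intro bop_eqI) metis
    then show False using H(3) unfolding scalar_operators_def by blast
  qed
  then obtain u where u: "(u::'h) \<noteq> 0" ..
  \<comment> \<open>Rayleigh quotients: if all of them equalled \<open>c\<close>, then
    \<open>H\<close> would be the scalar \<open>c\<close> by \<open>H_eq\<close>, so some
    \<open>v\<close> gives a different value \<open>d\<close>.\<close>
  define c where "c = h u / (norm u)\<^sup>2"
  have hu: "h u = c * (norm u)\<^sup>2" using u by (simp add: c_def)
  have "\<exists>v. h v \<noteq> c * (norm v)\<^sup>2"
    using H_eq[of c] H(3) unfolding scalar_operators_def by blast
  then obtain v where v: "h v \<noteq> c * (norm v)\<^sup>2" ..
  then have v0: "v \<noteq> 0" by (auto simp: h_def)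
  define d where "d = h v / (norm v)\<^sup>2"
  have hv: "h v = d * (norm v)\<^sup>2" using v0 by (simp add: d_def)
  have cd: "c \<noteq> d" using v hv by auto
  \<comment> \<open>The midpoint makes the quadratic form of \<open>H - l\<close> take both
    signs.\<close>
  define l where "l = (c + d) / 2"
  have "\<exists>p q. h p < l * (norm p)\<^sup>2 \<and> h q > l * (norm q)\<^sup>2"
  proof (cases "c < d")
    case True
    then have "h u < l * (norm u)\<^sup>2 \<and> h v > l * (norm v)\<^sup>2"
      using u v0 unfolding hu hv by (intro conjI mult_strict_right_mono) (auto simp: l_def)
    then show ?thesis by blast
  next
    case False
    then have "h v < l * (norm v)\<^sup>2 \<and> h u > l * (norm u)\<^sup>2"
      using u v0 cd unfolding hu hv by (intro conjI mult_strict_right_mono) (auto simp: l_def)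
    then show ?thesis by blast
  qed
  then obtain p q where pq: "h p < l * (norm p)\<^sup>2" "h q > l * (norm q)\<^sup>2" by blast
  define K0 where "K0 = H - of_real l *\<^sub>C 1"
  have K0: "K0 \<in> A" "adj K0 = K0" using H by (auto simp: K0_def adj_diff adj_scaleC)
  have K0_form: "Re (cinner (bop_apply K0 x) x) = h x - l * (norm x)\<^sup>2" for x
    by (simp add: K0_def h_def bop_apply_simps cinner_simps cinner_self del: of_real_power)
  obtain M where M: "M \<ge> 0" "\<And>x. norm (bop_apply K0 x) \<le> M * norm x"
    using bop_bounded by blast
  \<comment> \<open>Rescaling by a positive number keeps the signs and produces a contraction, as
    \<open>absolute_value\<close> demands.\<close>
  define t where "t = 1 / (M + 1)"
  have t: "t > 0" "t * M \<le> 1" using M(1) by (auto simp: t_def divide_le_eq)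
  define K where "K = of_real t *\<^sub>C K0"
  have K: "K \<in> A" "adj K = K" using K0 by (auto simp: K_def adj_scaleC)
  have K_form: "Re (cinner (bop_apply K x) x) = t * (h x - l * (norm x)\<^sup>2)" for x
    by (simp add: K_def bop_apply_simps cinner_simps K0_form)
  have "norm (bop_apply K x) \<le> norm x" for x
  proof -
    have "norm (bop_apply K x) \<le> t * (M * norm x)"
      using t M(2)[of x] by (simp add: K_def bop_apply_simps norm_scaleC)
    also have "\<dots> = (t * M) * norm x" by simp
    also have "\<dots> \<le> 1 * norm x" by (rule mult_right_mono[OF t(2)]) simp
    finally show ?thesis by simp
  qed
  from absolute_value[OF K this] obtain Y where Y: "Y \<in> A" "adj Y = Y" "Y * Y = K * K" "Y * K = K * Y"
    "\<And>x. 0 \<le> Re (cinner (bop_apply Y x) x)" by blast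
  have "Y - K \<noteq> 0"
  proof
    assume "Y - K = 0"
    then have "0 \<le> t * (h p - l * (norm p)\<^sup>2)" using Y(5)[of p] K_form[of p] by simp
    then show False using t pq(1) by (simp add: zero_le_mult_iff)
  qed
  moreover have "Y + K \<noteq> 0"
  proof
    assume "Y + K = 0"
    then have "Y = - K" by (simp add: add_eq_0_iff2)
    then have "0 \<le> - (t * (h q - l * (norm q)\<^sup>2))"
      using Y(5)[of q] K_form[of q] by (simp add: bop_apply_simps cinner_minus_left)
    moreover have "0 < t * (h q - l * (norm q)\<^sup>2)" using t pq(2) by simp
    ultimately show False by linarith
  qed
  \<comment> \<open>The kernel of \<open>Y - K\<close> contains the range of \<open>Y + K\<close>.
    For the projection \<open>P\<close> onto this kernel, \<open>P = 0\<close> would give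
    \<open>Y + K = 0\<close> and \<open>P = 1\<close> would give \<open>Y - K = 0\<close>.\<close>
  moreover have "(Y - K) * (Y + K) = 0"
    by (simp add: left_diff_distrib distrib_left Y)
  then have ker: "bop_apply (Y - K) (bop_apply (Y + K) x) = 0" for x
    by (metis bop_apply_simps(1,6))
  obtain P where P: "P \<in> A" "adj P = P" "(Y - K) * P = 0"
    "\<And>x. bop_apply (Y - K) x = 0 \<Longrightarrow> bop_apply P x = x"
    using kernel_projection[of "Y - K"] Y K by blast
  have "P * P = P"
  proof (rule bop_eqI)
    fix x
    have "bop_apply (Y - K) (bop_apply P x) = 0" by (metis P(3) bop_apply_simps(1,6))
    then show "bop_apply (P * P) x = bop_apply P x" using P(4) by (simp add: bop_apply_simps)
  qed
  moreover have "P * (Y + K) = Y + K"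
    by (rule bop_eqI) (metis P(4) ker bop_apply_simps(6))
  moreover note P(1-3)
  ultimately show ?thesis by (metis mult_zero_left mult_1_right)
qed

end

text \<open>The projection onto the joint kernel of all \<open>X * S\<close> is the strong limit of the decreasing
  net of projections onto the joint kernels of finitely many of them, and it is central.\<close>

lemma factor_prime:
  assumes factor: "factor A" and X: "X \<in> A" and Y: "Y \<in> A"
    and XY: "\<And>S. S \<in> A \<Longrightarrow> X * S * Y = 0"
  shows "X = 0 \<or> Y = 0"
proof -
  interpret von_neumann A using factor by unfold_locales (simp add: factor_def)
  have "\<exists>E. F \<subseteq> A \<longrightarrow> finite F \<longrightarrow> E \<in> A \<and> adj E = E \<and> (\<forall>S\<in>F. X * S * E = 0) \<and>
      (\<forall>x. (\<forall>S\<in>F. bop_apply (X * S) x = 0) \<longrightarrow> bop_apply E x = x)" for F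
    using joint_kernel_projection[of F "\<lambda>S. X * S"] X by (metis mult_in subsetD)
  then obtain e where e: "\<And>F. F \<subseteq> A \<Longrightarrow> finite F \<Longrightarrow> e F \<in> A \<and> adj (e F) = e F \<and>
      (\<forall>S\<in>F. X * S * e F = 0) \<and>
      (\<forall>x. (\<forall>S\<in>F. bop_apply (X * S) x = 0) \<longrightarrow> bop_apply (e F) x = x)"
    by metis
  \<comment> \<open>The value 0 off the finite subsets keeps membership, self-adjointness and the
    norm bound valid for every index.\<close>
  define E where "E F = (if F \<subseteq> A \<and> finite F then e F else 0)" for F
  have E_in: "E F \<in> A" and E_sa: "adj (E F) = E F" for F using e by (auto simp: E_def)
  have E_sa': "cinner (bop_apply (E F) x) y = cinner x (bop_apply (E F) y)" for F x y
    by (metis E_sa cinner_adj_left)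
  have E_ann: "bop_apply (X * S) (bop_apply (E F) x) = 0" if "F \<subseteq> A" "finite F" "S \<in> F" for F S x
  proof -
    have "X * S * E F = 0" using e[OF that(1,2)] that by (simp add: E_def)
    then show ?thesis by (metis bop_apply_simps(1,6))
  qed
  have E_fix: "bop_apply (E F) x = x"
    if "F \<subseteq> A" "finite F" "\<And>S. S \<in> F \<Longrightarrow> bop_apply (X * S) x = 0" for F x
    using e[OF that(1,2)] that by (simp add: E_def)
  \<comment> \<open>A larger \<open>G\<close> has a smaller joint kernel, so \<open>E F\<close>
    fixes the range of \<open>E G\<close>.\<close>
  have E_dec: "bop_apply (E F) (bop_apply (E G) x) = bop_apply (E G) x"
    if "F \<subseteq> G" "G \<subseteq> A" "finite G" for F G x
    by (rule E_fix) (use that E_ann finite_subset in auto)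
  define n where "n F x = (norm (bop_apply (E F) x))\<^sup>2" for F x
  \<comment> \<open>Pythagoras for nested projections: convergence of the vectors is governed by the
    decreasing net of numbers \<open>n F x\<close>.\<close>
  have E_dist: "(norm (bop_apply (E F) x - bop_apply (E G) x))\<^sup>2 = n F x - n G x"
    if "F \<subseteq> G" "G \<subseteq> A" "finite G" for F G x
  proof -
    have "cinner (bop_apply (E F) x) (bop_apply (E G) x) = cinner x (bop_apply (E G) x)"
      using E_sa' E_dec that by simp
    also have "\<dots> = cinner (bop_apply (E G) x) (bop_apply (E G) x)"
      using E_sa' E_dec[of G G x] that by simp
    finally show ?thesis by (simp add: norm_diff_sq n_def cinner_self del: of_real_power)
  qed
  define \<F> where "\<F> = finite_subsets_at_top A"
  have "\<exists>z. ((\<lambda>F. bop_apply (E F) x) \<longlongrightarrow> z) \<F>" for x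
  proof -
    define N where "N = {n F x |F. F \<subseteq> A \<and> finite F}"
    define m where "m = Inf N"
    have "N \<noteq> {}" unfolding N_def by blast
    have bdd: "bdd_below N" by (rule bdd_belowI[of _ 0]) (auto simp: N_def n_def)
    have m_le: "m \<le> n F x" if "F \<subseteq> A" "finite F" for F
      unfolding m_def by (rule cInf_lower[OF _ bdd]) (use that in \<open>auto simp: N_def\<close>)
    have "\<exists>F. F \<subseteq> A \<and> finite F \<and> n F x < m + 1 / real (Suc k)" for k
      using cInf_lessD[OF \<open>N \<noteq> {}\<close>, of "m + 1 / real (Suc k)"] by (auto simp: m_def N_def)
    then obtain f where f: "\<And>k. f k \<subseteq> A" "\<And>k. finite (f k)" "\<And>k. n (f k) x < m + 1 / real (Suc k)"
      by metis
    \<comment> \<open>The near-minimal sets \<open>f k\<close> need not be nested; their unions are,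
      and stay near-minimal because \<open>n\<close> decreases.\<close>
    define G where "G k = (\<Union>i\<le>k. f i)" for k
    have G: "G k \<subseteq> A" "finite (G k)" "f k \<subseteq> G k" for k using f by (auto simp: G_def)
    have dist: "(norm (bop_apply (E (G k)) x - bop_apply (E F) x))\<^sup>2 < 1 / real (Suc k)"
      if F: "G k \<subseteq> F" "F \<subseteq> A" "finite F" for k F
    proof -
      have "0 \<le> n (f k) x - n (G k) x"
        using E_dist[of "f k" "G k" x] G by (metis zero_le_power2)
      then show ?thesis using E_dist[OF F, of x] m_le[OF F(2,3)] f(3)[of k] by simp
    qed
    have small: "\<exists>k. \<forall>F. G k \<subseteq> F \<longrightarrow> F \<subseteq> A \<longrightarrow> finite F \<longrightarrow>
        norm (bop_apply (E (G k)) x - bop_apply (E F) x) < r" if r: "r > 0" for r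
    proof -
      obtain k where "inverse (real (Suc k)) < r\<^sup>2"
        using reals_Archimedean[of "r\<^sup>2"] r by auto
      then have "norm (bop_apply (E (G k)) x - bop_apply (E F) x) < r"
        if "G k \<subseteq> F" "F \<subseteq> A" "finite F" for F
        using dist[OF that] r by (intro power2_less_imp_less[of _ r]) (auto simp: inverse_eq_divide)
      then show ?thesis by blast
    qed
    have G_mono: "G i \<subseteq> G j" if "i \<le> j" for i j using that by (fastforce simp: G_def)
    have "Cauchy (\<lambda>k. bop_apply (E (G k)) x)"
    proof (rule CauchyI)
      fix r :: real assume r: "0 < r"
      obtain k where k: "\<And>F. G k \<subseteq> F \<Longrightarrow> F \<subseteq> A \<Longrightarrow> finite F \<Longrightarrow>
          norm (bop_apply (E (G k)) x - bop_apply (E F) x) < r / 2"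
        using small[of "r / 2"] r by auto
      have "norm (bop_apply (E (G i)) x - bop_apply (E (G j)) x) < r / 2 + r / 2"
        if "k \<le> i" "k \<le> j" for i j
        by (rule norm_diff_triangle_less[where y = "bop_apply (E (G k)) x"])
          (use k[OF G_mono[OF that(1)] G(1,2)] k[OF G_mono[OF that(2)] G(1,2)] in
            \<open>simp_all add: norm_minus_commute\<close>)
      then show "\<exists>M. \<forall>i\<ge>M. \<forall>j\<ge>M. norm (bop_apply (E (G i)) x - bop_apply (E (G j)) x) < r"
        by auto
    qed
    then obtain z where z: "(\<lambda>k. bop_apply (E (G k)) x) \<longlonglongrightarrow> z"
      using Cauchy_convergent_iff convergent_def by blast
    have "((\<lambda>F. bop_apply (E F) x) \<longlongrightarrow> z) \<F>"
    proof (rule tendstoI)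
      fix r :: real assume r: "0 < r"
      obtain k where k: "\<And>F. G k \<subseteq> F \<Longrightarrow> F \<subseteq> A \<Longrightarrow> finite F \<Longrightarrow>
          norm (bop_apply (E (G k)) x - bop_apply (E F) x) < r / 4"
        using small[of "r / 4"] r by auto
      have "\<forall>\<^sub>F i in sequentially. norm (bop_apply (E (G k)) x - bop_apply (E (G i)) x) \<le> r / 4"
        unfolding eventually_sequentially using k[OF G_mono G(1,2)] less_imp_le by blast
      then have "norm (bop_apply (E (G k)) x - z) \<le> r / 4"
        by (intro tendsto_upperbound[OF tendsto_norm[OF tendsto_diff[OF tendsto_const z]]]) auto
      then have "dist (bop_apply (E F) x) z < r" if "G k \<subseteq> F" "F \<subseteq> A" "finite F" for F
        using k[OF that] r norm_triangle_sub[of "bop_apply (E F) x - z" "bop_apply (E (G k)) x - z"]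
        by (simp add: dist_norm norm_minus_commute)
      then show "\<forall>\<^sub>F F in \<F>. dist (bop_apply (E F) x) z < r"
        unfolding \<F>_def eventually_finite_subsets_at_top
        by (intro exI[of _ "G k"]) (simp add: G)
    qed
    then show ?thesis by blast
  qed
  then obtain g where g: "\<And>x. ((\<lambda>F. bop_apply (E F) x) \<longlongrightarrow> g x) \<F>" by metis
  have \<F>: "\<F> \<noteq> bot" by (simp add: \<F>_def)
  have E_contr: "norm (bop_apply (E F) x) \<le> 1 * norm x" for F x
  proof (cases "F \<subseteq> A \<and> finite F")
    case True
    have "cinner (bop_apply (E F) x) (bop_apply (E F) x) = cinner (bop_apply (E F) x) x"
      using E_sa' E_dec[of F F x] True by simp
    then have "(norm (bop_apply (E F) x))\<^sup>2 \<le> norm (bop_apply (E F) x) * norm x"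
      using Cauchy_Schwarz_cinner[of "bop_apply (E F) x" x]
      by (metis cinner_self norm_of_real abs_power2)
    then show ?thesis by (cases "bop_apply (E F) x = 0") (auto simp: power2_eq_square)
  next
    case False
    then show ?thesis by (auto simp: E_def bop_apply_simps)
  qed
  obtain P where P: "P \<in> A" "bop_apply P = g"
    using strong_limit_exists[OF wot_closed \<F> E_in E_contr g] by blast
  have "cinner (g x) y = cinner x (g y)" for x y
  proof (rule tendsto_unique[OF \<F>])
    show "((\<lambda>F. cinner (bop_apply (E F) x) y) \<longlongrightarrow> cinner (g x) y) \<F>" by (intro tendsto_intros g)
    show "((\<lambda>F. cinner (bop_apply (E F) x) y) \<longlongrightarrow> cinner x (g y)) \<F>"
      unfolding E_sa' by (intro tendsto_intros g)
  qed
  then have P_sa: "adj P = P" by (intro adj_eqI) (simp add: P)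
  have P_ann: "bop_apply (X * S) (g x) = 0" if S: "S \<in> A" for S x
  proof (rule tendsto_unique[OF \<F> tendsto_bop[OF g]])
    have "\<forall>\<^sub>F F in \<F>. bop_apply (X * S) (bop_apply (E F) x) = 0"
      unfolding \<F>_def eventually_finite_subsets_at_top
      by (rule exI[of _ "{S}"]) (use S E_ann in auto)
    then show "((\<lambda>F. bop_apply (X * S) (bop_apply (E F) x)) \<longlongrightarrow> 0) \<F>"
      by (rule tendsto_eventually)
  qed
  have P_fix: "g x = x" if "\<And>S. S \<in> A \<Longrightarrow> bop_apply (X * S) x = 0" for x
  proof (rule tendsto_unique[OF \<F> g])
    have "\<forall>\<^sub>F F in \<F>. bop_apply (E F) x = x"
      unfolding \<F>_def by (rule eventually_finite_subsets_at_top_weakI) (blast intro: E_fix that)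
    then show "((\<lambda>F. bop_apply (E F) x) \<longlongrightarrow> x) \<F>" by (rule tendsto_eventually)
  qed
  \<comment> \<open>The joint kernel is invariant under \<open>A\<close>, because
    \<open>S * T\<close> is again an admissible \<open>S\<close>. Invariance under
    \<open>adj T\<close> as well yields commutation with \<open>P\<close>.\<close>
  have PTP: "P * T * P = T * P" if T: "T \<in> A" for T
  proof (rule bop_eqI)
    fix x
    have "bop_apply (X * S) (bop_apply T (g x)) = 0" if "S \<in> A" for S
      using P_ann[of "S * T" x] that T by (simp add: bop_apply_simps)
    then show "bop_apply (P * T * P) x = bop_apply (T * P) x"
      using P_fix by (simp add: bop_apply_simps P)
  qed
  have "P * T = T * P" if T: "T \<in> A" for T
    using PTP[OF T] arg_cong[OF PTP[OF adj_in[OF T]], of adj]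
    by (simp add: adj_mult P_sa mult.assoc)
  then have "P \<in> scalar_operators" using factor P unfolding factor_def center_def by blast
  then obtain c where c: "P = c *\<^sub>C 1" unfolding scalar_operators_def by blast
  \<comment> \<open>With \<open>P = c\<close>, the relations \<open>X * P = 0\<close> and
    \<open>P * Y = Y\<close> leave two cases: a nonzero \<open>c\<close> forces
    \<open>X = 0\<close>, and \<open>c = 0\<close> forces \<open>Y = 0\<close>.\<close>
  have "X * P = 0"
    by (rule bop_eqI) (use P_ann[of 1] in \<open>simp add: bop_apply_simps P\<close>)
  then have "c = 0 \<or> X = 0" by (simp add: c scaleC_mult_right scaleC_eq_0_iff)
  moreover have "P * Y = Y"
  proof (rule bop_eqI)
    fix x
    have "bop_apply (X * S) (bop_apply Y x) = 0" if "S \<in> A" for S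
      using XY[OF that] by (metis bop_apply_simps(1,6))
    then show "bop_apply (P * Y) x = bop_apply Y x" using P_fix by (simp add: bop_apply_simps P)
  qed
  ultimately show ?thesis by (auto simp: c)
qed

section \<open>Additivity of Jordan multiplicative maps\<close>

definition self_adjoints :: "'h::complex_hilbert bop set \<Rightarrow> 'h bop set" where
  "self_adjoints A = {X \<in> A. adj X = X}"

text \<open>Without the customary factor 1/2, so that \<open>jordan P\<close> for a projection
  \<open>P\<close> has the eigenvalues 2, 1 and 0 on the Peirce blocks.\<close>

definition jordan :: "'a::ring \<Rightarrow> 'a \<Rightarrow> 'a" where
  "jordan X Y = X * Y + Y * X"

lemma jordan_simps:
  "jordan X 0 = 0" "jordan 0 X = 0"
  "jordan X (Y + Z) = jordan X Y + jordan X Z" "jordan (X + Y) Z = jordan X Z + jordan Y Z"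
  "jordan X (Y - Z) = jordan X Y - jordan X Z" "jordan (X - Y) Z = jordan X Z - jordan Y Z"
  by (simp_all add: jordan_def algebra_simps)

lemma jordan_scaleC:
  "jordan (c *\<^sub>C X) Y = c *\<^sub>C jordan X Y" "jordan X (c *\<^sub>C Y) = c *\<^sub>C jordan X Y"
  for X Y :: "'h::complex_hilbert bop"
  by (simp_all add: jordan_def scaleC_mult_left scaleC_mult_right scaleC_add_right)

lemma jordan_commute: "jordan X Y = jordan Y X"
  by (simp add: jordan_def add.commute)

lemma scaleC_2: "2 *\<^sub>C x = x + (x::'a::complex_vector)"
  using scaleC_add_left[of 1 1 x] by (simp add: scaleC_one)

lemma double_inject: "x + x = y + y \<longleftrightarrow> x = (y::'a::real_vector)"
  by (metis scaleR_2 scaleR_left_imp_eq zero_neq_numeral)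

locale nonscalar_factor =
  fixes A :: "'h::complex_hilbert bop set"
  assumes factor: "factor A" and nonscalar: "\<not> A \<subseteq> scalar_operators"

sublocale nonscalar_factor \<subseteq> von_neumann A
  using factor by unfold_locales (simp add: factor_def)

context nonscalar_factor
begin

lemma self_adjoints_closed:
  "0 \<in> self_adjoints A" "1 \<in> self_adjoints A"
  "X \<in> self_adjoints A \<Longrightarrow> Y \<in> self_adjoints A \<Longrightarrow> X + Y \<in> self_adjoints A"
  "X \<in> self_adjoints A \<Longrightarrow> Y \<in> self_adjoints A \<Longrightarrow> X - Y \<in> self_adjoints A"
  "X \<in> self_adjoints A \<Longrightarrow> Y \<in> self_adjoints A \<Longrightarrow> jordan X Y \<in> self_adjoints A"
  "X \<in> self_adjoints A \<Longrightarrow> - X \<in> self_adjoints A"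
  "X \<in> self_adjoints A \<Longrightarrow> of_real r *\<^sub>C X \<in> self_adjoints A"
  "X \<in> self_adjoints A \<Longrightarrow> Y \<in> self_adjoints A \<Longrightarrow> \<i> *\<^sub>C (X * Y - Y * X) \<in> self_adjoints A"
  by (auto simp: self_adjoints_def jordan_def adj_add adj_diff adj_mult adj_minus adj_scaleC)
    (metis minus_diff_eq scaleC_minus1_left scaleC_scaleC mult_minus1_right minus_minus mult_minus_left)

section \<open>Peirce calculus for a proper projection\<close>

definition proper_projection :: "'h bop \<Rightarrow> bool" where
  "proper_projection P \<longleftrightarrow> P \<in> self_adjoints A \<and> P * P = P \<and> P \<noteq> 0 \<and> P \<noteq> 1"

definition diag :: "'h bop \<Rightarrow> 'h bop \<Rightarrow> bool" where
  "diag P X \<longleftrightarrow> X \<in> self_adjoints A \<and> P * X = X \<and> X * P = X"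

text \<open>For a projection \<open>P\<close>, multiplying \<open>P * X + X * P = X\<close> on both
  sides by \<open>P\<close>, or on both sides by \<open>1 - P\<close>, shows that the two diagonal
  blocks vanish.\<close>

definition off_diag :: "'h bop \<Rightarrow> 'h bop \<Rightarrow> bool" where
  "off_diag P X \<longleftrightarrow> X \<in> self_adjoints A \<and> jordan P X = X"

lemma proper_projection_exists: "\<exists>P. proper_projection P"
  using nontrivial_projection[OF nonscalar] by (auto simp: proper_projection_def self_adjoints_def)

lemma proper_projection_compl: "proper_projection P \<Longrightarrow> proper_projection (1 - P)"
  by (auto simp: proper_projection_def self_adjoints_closed algebra_simps)

lemma diagI:
  assumes X: "X \<in> self_adjoints A" and PX: "P * X = X" and P: "proper_projection P"
  shows "diag P X"
proof -
  have "adj X = X" "adj P = P" using X P by (auto simp: self_adjoints_def proper_projection_def)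
  then have "X * P = X" using arg_cong[OF PX, of adj] by (simp add: adj_mult)
  then show ?thesis using X PX by (simp add: diag_def)
qed

lemma diag_in: "diag P X \<Longrightarrow> X \<in> self_adjoints A"
  and off_diag_in: "off_diag P X \<Longrightarrow> X \<in> self_adjoints A"
  and proper_projection_in: "proper_projection P \<Longrightarrow> P \<in> self_adjoints A"
  by (simp_all add: diag_def off_diag_def proper_projection_def)

lemma jordan_diag:
  assumes "diag P X"
  shows "jordan P X = X + X" "jordan (1 - P) X = 0"
  using assms by (simp_all add: diag_def jordan_def left_diff_distrib right_diff_distrib)

lemma jordan_compl: "jordan (1 - P) X = X + X - jordan P X" for P X :: "'h bop"
  by (simp add: jordan_def left_diff_distrib right_diff_distrib)

text \<open>With \<open>Q = 1 - P\<close>, multiplying \<open>Q * X + X * Q = 0\<close> by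
  \<open>Q\<close> from the left and from the right gives \<open>Q * X = X * Q\<close>, so
  \<open>Q * X\<close> is its own negative.\<close>

lemma diag_jordan_zero:
  assumes P: "proper_projection P" and X: "X \<in> self_adjoints A" and JX: "jordan (1 - P) X = 0"
  shows "diag P X"
proof -
  define Q where "Q = 1 - P"
  have QQ: "Q * Q = Q" using proper_projection_compl[OF P] by (simp add: Q_def proper_projection_def)
  have *: "Q * X + X * Q = 0" using JX by (simp add: jordan_def Q_def)
  have 1: "Q * X + Q * (X * Q) = 0"
    using arg_cong[OF *, of "\<lambda>Z. Q * Z"] QQ by (simp add: distrib_left mult.assoc[symmetric])
  have 2: "Q * (X * Q) + X * Q = 0"
    using arg_cong[OF *, of "\<lambda>Z. Z * Q"] QQ by (simp add: distrib_right mult.assoc)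
  have "Q * X = X * Q" using 1 2 by (metis add.commute add_right_imp_eq)
  with * have "Q * X + Q * X = 0 + 0" by simp
  then have "Q * X = 0" unfolding double_inject .
  then have "P * X = X" by (simp add: Q_def left_diff_distrib)
  then show ?thesis by (rule diagI[OF X _ P])
qed

lemma off_diag_compl: "off_diag P X \<Longrightarrow> off_diag (1 - P) X"
  by (simp add: off_diag_def jordan_compl)

lemma off_diag_add: "off_diag P X \<Longrightarrow> off_diag P Y \<Longrightarrow> off_diag P (X + Y)"
  by (simp add: off_diag_def self_adjoints_closed jordan_simps)

text \<open>In block form \<open>S * Y\<close> and \<open>Y * S\<close> occupy one off-diagonal
  block each, since \<open>S\<close> has no diagonal blocks and \<open>Y\<close> lies in one
  corner.\<close>

lemma off_diag_jordan_diag: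
  assumes S: "off_diag P S" and Y: "diag P Y"
  shows "off_diag P (jordan S Y)"
proof -
  have PS: "P * S + S * P = S" using S by (simp add: off_diag_def jordan_def)
  have y: "P * Y = Y" "Y * P = Y" using Y by (simp_all add: diag_def)
  have "P * S * Y + S * (P * Y) = S * Y" using PS by (metis distrib_right mult.assoc)
  then have 1: "P * (S * Y) = 0" by (simp add: y mult.assoc)
  have "(Y * P) * S + Y * S * P = Y * S" using PS by (metis distrib_left mult.assoc)
  then have 2: "Y * (S * P) = 0" by (simp add: y mult.assoc)
  have "P * (Y * S) = Y * S" "S * Y * P = S * Y" by (simp_all add: y mult.assoc[symmetric], simp add: y mult.assoc)
  then have "jordan P (jordan S Y) = jordan S Y"
    by (simp add: jordan_def distrib_left distrib_right 1 2 mult.assoc)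
  then show ?thesis
    using S Y by (simp add: off_diag_def diag_def self_adjoints_closed)
qed

lemma jordan_off_diag_commutes:
  assumes "off_diag P S" "off_diag P X"
  shows "P * jordan S X = jordan S X * P"
proof -
  have *: "P * (S * X) = S * X * P" if "off_diag P S" "off_diag P X" for S X
  proof -
    have "P * S = S - S * P" "P * X = X - X * P"
      using that by (simp_all add: off_diag_def jordan_def eq_diff_eq)
    then show ?thesis by (metis (no_types) diff_diff_eq2 mult.assoc left_diff_distrib right_diff_distrib add_diff_cancel_left')
  qed
  show ?thesis using *[OF assms] *[OF assms(2,1)] by (simp add: jordan_def distrib_left distrib_right)
qed

text \<open>On block diagonal elements \<open>jordan (1 - P)\<close> leaves only one corner, which
  \<open>jordan P\<close> kills, while both act as the identity on off-diagonal ones. The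
  composition extracts the off-diagonal part by operations that a Jordan multiplicative map
  respects.\<close>

lemma jordan_jordan_commuting:
  assumes P: "proper_projection P" and "P * W = W * P"
  shows "jordan P (jordan (1 - P) W) = 0"
proof -
  have PP: "P * P = P" using P by (simp add: proper_projection_def)
  have J: "jordan P W = P * W + P * W" by (simp add: jordan_def assms(2))
  have "P * (P * W) = P * W" by (simp add: mult.assoc[symmetric] PP)
  moreover have "P * W * P = P * W" by (simp add: assms(2) mult.assoc PP)
  ultimately have "jordan P (P * W) = P * W + P * W" by (simp add: jordan_def)
  then have "jordan P (jordan P W) = jordan P W + jordan P W" unfolding J by (simp add: jordan_simps)
  then show ?thesis by (simp add: jordan_compl jordan_simps(3,5))
qed

text \<open>Every \<open>S\<close> in \<open>A\<close> yields an off-diagonal self-adjoint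
  \<open>Z\<close>, the block \<open>Q * S * P\<close> plus its adjoint. Multiplying
  \<open>jordan Z Y = 0\<close> by \<open>Q\<close> from the left isolates
  \<open>Q * S * Y = 0\<close>, and primeness applies.\<close>

lemma diag_faithful:
  assumes P: "proper_projection P" and Y: "diag P Y"
    and ann: "\<And>S. off_diag P S \<Longrightarrow> jordan S Y = 0"
  shows "Y = 0"
proof -
  define Q where "Q = 1 - P"
  have P': "P \<in> A" "adj P = P" "P * P = P" using P by (auto simp: proper_projection_def self_adjoints_def)
  have Q: "Q \<in> A" "adj Q = Q" "Q * Q = Q" "P * Q = 0" "Q * P = 0"
    using P' by (simp_all add: Q_def adj_diff left_diff_distrib right_diff_distrib)
  have y: "P * Y = Y" "Q * Y = 0" using Y by (simp_all add: diag_def Q_def left_diff_distrib)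
  have assoc: "P * (P * Z) = P * Z" "Q * (Q * Z) = Q * Z" "P * (Q * Z) = 0" "Q * (P * Z) = 0"
    "P * (Y * Z) = Y * Z" "Q * (Y * Z) = 0" for Z
    by (simp_all add: mult.assoc[symmetric] P' Q y)
  have "Q * S * Y = 0" if S: "S \<in> A" for S
  proof -
    define Z where "Z = Q * (S * P) + P * (adj S * Q)"
    have "off_diag P Z"
      using S P' Q by (simp add: Z_def off_diag_def self_adjoints_def jordan_def adj_add adj_mult
          distrib_left distrib_right mult.assoc assoc add.commute)
    then have "Q * jordan Z Y = 0" using ann by simp
    then show ?thesis
      by (simp add: jordan_def Z_def distrib_left distrib_right mult.assoc assoc y)
  qed
  moreover have "Q \<noteq> 0" using P by (auto simp: Q_def proper_projection_def)
  ultimately show ?thesis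
    using factor_prime[OF factor Q(1), of Y] Y by (auto simp: diag_def self_adjoints_def)
qed

lemma peirce_decomposition:
  assumes P: "proper_projection P" and X: "X \<in> self_adjoints A"
  shows "\<exists>a x b. diag P a \<and> off_diag P x \<and> diag (1 - P) b \<and> X = a + x + b"
proof -
  define Q where "Q = 1 - P"
  have P': "P \<in> A" "adj P = P" "P * P = P" using P by (auto simp: proper_projection_def self_adjoints_def)
  have Q: "Q \<in> A" "adj Q = Q" "Q * Q = Q" "P * Q = 0" "Q * P = 0"
    using P' by (simp_all add: Q_def adj_diff left_diff_distrib right_diff_distrib)
  have assoc: "P * (P * Z) = P * Z" "Q * (Q * Z) = Q * Z" "P * (Q * Z) = 0" "Q * (P * Z) = 0" for Z
    by (simp_all add: mult.assoc[symmetric] P' Q)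
  have X': "X \<in> A" "adj X = X" using X by (simp_all add: self_adjoints_def)
  note simps = self_adjoints_def jordan_def adj_add adj_mult distrib_left distrib_right mult.assoc assoc P' Q X'
  have "diag P (P * (X * P))" "off_diag P (P * (X * Q) + Q * (X * P))" "diag Q (Q * (X * Q))"
    by (simp_all add: diag_def off_diag_def simps add.commute)
  moreover have "X = (P + Q) * (X * (P + Q))" by (simp add: Q_def)
  then have "X = P * (X * P) + (P * (X * Q) + Q * (X * P)) + Q * (X * Q)"
    by (simp only: distrib_left distrib_right mult.assoc) (simp add: add_ac)
  ultimately show ?thesis unfolding Q_def by blast
qed

end

section \<open>Additivity, one Peirce block at a time\<close>

locale jordan_map = nonscalar_factor A for A :: "'h::complex_hilbert bop set" +
  fixes f :: "'h bop \<Rightarrow> 'k::complex_hilbert bop" and d :: complex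
  assumes jordan: "X \<in> self_adjoints A \<Longrightarrow> Y \<in> self_adjoints A \<Longrightarrow>
      f (jordan X Y) = d *\<^sub>C jordan (f X) (f Y)"
    and inj: "X \<in> self_adjoints A \<Longrightarrow> Y \<in> self_adjoints A \<Longrightarrow> f X = f Y \<Longrightarrow> X = Y"
    and closed: "X \<in> self_adjoints A \<Longrightarrow> Y \<in> self_adjoints A \<Longrightarrow>
      \<exists>T\<in>self_adjoints A. f T = f X + f Y"
    and zero: "f 0 = 0"
begin

text \<open>The substitute for additivity: if \<open>T\<close> is a preimage of
  \<open>f X + f Y\<close>, which \<open>closed\<close> provides, the same relation holds after
  Jordan multiplication by any \<open>S\<close>. Choosing \<open>S\<close> so that one summand dies
  lets \<open>inj\<close> compute parts of \<open>T\<close>, with the goal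
  \<open>T = X + Y\<close>.\<close>

lemma jordan_add:
  assumes "S \<in> self_adjoints A" "T \<in> self_adjoints A" "X \<in> self_adjoints A" "Y \<in> self_adjoints A"
    and "f T = f X + f Y"
  shows "f (jordan S T) = f (jordan S X) + f (jordan S Y)"
  using assms by (simp add: jordan jordan_simps scaleC_add_right)

lemma add_diag_diag:
  assumes P: "proper_projection P" and a: "diag P a" and b: "diag (1 - P) b"
  shows "f (a + b) = f a + f b"
proof -
  note in_sa = diag_in[OF a] diag_in[OF b] proper_projection_in[OF P]
    proper_projection_in[OF proper_projection_compl[OF P]]
  obtain T where T: "T \<in> self_adjoints A" "f T = f a + f b" using closed[OF in_sa(1,2)] by blast
  have "jordan P b = 0" using jordan_diag(2)[OF b] by simp
  then have "f (jordan P T) = f (a + a)"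
    using jordan_add[OF in_sa(3) T(1) in_sa(1,2) T(2)] by (simp add: jordan_diag[OF a] zero)
  then have 1: "jordan P T = a + a"
    by (rule inj[rotated 2]) (simp_all add: in_sa T self_adjoints_closed)
  have "f (jordan (1 - P) T) = f (b + b)"
    using jordan_add[OF in_sa(4) T(1) in_sa(1,2) T(2)]
    by (simp add: jordan_diag[OF a] jordan_diag[OF b] zero)
  then have "jordan (1 - P) T = b + b"
    by (rule inj[rotated 2]) (simp_all add: in_sa T self_adjoints_closed)
  then have "T + T = (a + b) + (a + b)" unfolding jordan_compl 1 by (simp add: algebra_simps)
  then show ?thesis using T unfolding double_inject by simp
qed

text \<open>Jordan multiplication by \<open>1 - P\<close> kills \<open>a\<close> and fixes
  \<open>x\<close>, which leaves only a corner error \<open>y\<close>. Testing against an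
  off-diagonal \<open>S\<close> detects it: \<open>jordan S x\<close> is block diagonal, so
  \<open>L\<close> kills it and injectivity applies to a single term, while \<open>L\<close> fixes
  \<open>jordan S y\<close>.\<close>

lemma add_diag_off_diag:
  assumes P: "proper_projection P" and a: "diag P a" and x: "off_diag P x"
  shows "f (a + x) = f a + f x"
proof -
  note in_sa = diag_in[OF a] off_diag_in[OF x] proper_projection_in[OF P]
    proper_projection_in[OF proper_projection_compl[OF P]]
  have Jx: "jordan (1 - P) x = x" using off_diag_compl[OF x] by (simp add: off_diag_def)
  obtain T where T: "T \<in> self_adjoints A" "f T = f a + f x" using closed[OF in_sa(1,2)] by blast
  have "f (jordan (1 - P) T) = f x"
    using jordan_add[OF in_sa(4) T(1) in_sa(1,2) T(2)] by (simp add: jordan_diag[OF a] Jx zero)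
  then have JT: "jordan (1 - P) T = x"
    by (rule inj[rotated 2]) (simp_all add: in_sa T self_adjoints_closed)
  define y where "y = T - (a + x)"
  have y_in: "y \<in> self_adjoints A" using T in_sa by (simp add: y_def self_adjoints_closed)
  have y: "diag P y"
    by (rule diag_jordan_zero[OF P y_in]) (simp add: y_def jordan_simps(3,5) JT Jx jordan_diag[OF a])
  have "jordan S y = 0" if S: "off_diag P S" for S
  proof -
    define L where "L Z = jordan P (jordan (1 - P) (jordan S Z))" for Z
    note S_in = off_diag_in[OF S]
    have L_in: "L Z \<in> self_adjoints A" if "Z \<in> self_adjoints A" for Z
      using that in_sa S_in by (simp add: L_def self_adjoints_closed)
    have 1: "f (jordan S T) = f (jordan S a) + f (jordan S x)"
      by (rule jordan_add[OF S_in T(1) in_sa(1,2) T(2)])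
    have 2: "f (jordan (1 - P) (jordan S T)) =
        f (jordan (1 - P) (jordan S a)) + f (jordan (1 - P) (jordan S x))"
      by (rule jordan_add[OF in_sa(4) _ _ _ 1]) (simp_all add: S_in T in_sa self_adjoints_closed)
    have "f (L T) = f (L a) + f (L x)" unfolding L_def
      by (rule jordan_add[OF in_sa(3) _ _ _ 2]) (simp_all add: S_in T in_sa self_adjoints_closed)
    moreover have Lx: "L x = 0" unfolding L_def
      by (rule jordan_jordan_commuting[OF P jordan_off_diag_commutes[OF S x]])
    ultimately have "f (L T) = f (L a)" by (simp add: zero)
    then have "L T = L a" using inj L_in T in_sa by metis
    then have "L y = 0" using Lx by (simp add: L_def y_def jordan_simps)
    moreover have "off_diag P (jordan S y)" by (rule off_diag_jordan_diag[OF S y])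
    then have "L y = jordan S y"
      using off_diag_compl by (simp add: L_def off_diag_def)
    ultimately show ?thesis by simp
  qed
  then have "y = 0" by (rule diag_faithful[OF P y])
  then show ?thesis using T by (simp add: y_def)
qed

text \<open>\<open>jordan P\<close> kills \<open>b\<close> and gives its half of \<open>T\<close>
  outright; \<open>jordan (1 - P)\<close> produces \<open>f x + f (b + b)\<close>, which the
  previous case merges for the complementary projection.\<close>

lemma add_peirce:
  assumes P: "proper_projection P" and a: "diag P a" and x: "off_diag P x" and b: "diag (1 - P) b"
  shows "f (a + x + b) = f a + f x + f b"
proof -
  note P' = proper_projection_compl[OF P]
  note in_sa = diag_in[OF a] off_diag_in[OF x] diag_in[OF b] proper_projection_in[OF P]
    proper_projection_in[OF P']
  have ax: "a + x \<in> self_adjoints A" using in_sa by (simp add: self_adjoints_closed)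
  have x': "jordan P x = x" "jordan (1 - P) x = x"
    using x off_diag_compl[OF x] by (simp_all add: off_diag_def)
  have b': "jordan P b = 0" using jordan_diag(2)[OF b] by simp
  obtain T where T: "T \<in> self_adjoints A" "f T = f (a + x) + f b" using closed[OF ax in_sa(3)] by blast
  have "f (jordan P T) = f (a + a + x)"
    using jordan_add[OF in_sa(4) T(1) ax in_sa(3) T(2)]
    by (simp add: jordan_simps(3) jordan_diag[OF a] x' b' zero)
  then have 1: "jordan P T = a + a + x"
    by (rule inj[rotated 2]) (simp_all add: in_sa T self_adjoints_closed)
  have "f (jordan (1 - P) T) = f x + f (b + b)"
    using jordan_add[OF in_sa(5) T(1) ax in_sa(3) T(2)]
    by (simp add: jordan_simps(3) jordan_diag[OF a] jordan_diag[OF b] x' zero)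
  also have "\<dots> = f (b + b + x)"
  proof -
    have "diag (1 - P) (b + b)"
      using b by (simp add: diag_def self_adjoints_closed distrib_left distrib_right)
    from add_diag_off_diag[OF P' this off_diag_compl[OF x]] show ?thesis by simp
  qed
  finally have "jordan (1 - P) T = b + b + x"
    by (rule inj[rotated 2]) (simp_all add: in_sa T self_adjoints_closed)
  then have "T + T = (a + x + b) + (a + x + b)" unfolding jordan_compl 1 by (simp add: algebra_simps)
  then show ?thesis
    using T add_diag_off_diag[OF P a x] unfolding double_inject by simp
qed

text \<open>Expand \<open>jordan (P + x) (1 - P + y) = x + y + jordan x y\<close>; its last term is block diagonal.\<close>

lemma add_off_diag:
  assumes P: "proper_projection P" and x: "off_diag P x" and y: "off_diag P y"
  shows "f (x + y) = f x + f y"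
proof -
  define Q where "Q = 1 - P"
  have Q: "proper_projection Q" using proper_projection_compl[OF P] by (simp add: Q_def)
  note in_sa = off_diag_in[OF x] off_diag_in[OF y] proper_projection_in[OF P] proper_projection_in[OF Q]
  define w where "w = jordan x y"
  have w: "w \<in> self_adjoints A" "P * w = w * P"
    using in_sa jordan_off_diag_commutes[OF x y] by (auto simp: w_def self_adjoints_closed)
  have PP: "P * P = P" "adj P = P" "P \<in> A" using P by (auto simp: proper_projection_def self_adjoints_def)
  have Pw: "P * w \<in> self_adjoints A" using w PP by (auto simp: self_adjoints_def adj_mult)
  have a: "diag P (P * w)"
    by (rule diagI[OF Pw _ P]) (simp add: mult.assoc[symmetric] PP)
  have Qw: "Q * w = w - P * w" by (simp add: Q_def left_diff_distrib)
  have b: "diag Q (Q * w)"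
  proof (rule diagI[OF _ _ Q])
    show "Q * w \<in> self_adjoints A" using w Pw by (simp add: Qw self_adjoints_closed)
    show "Q * (Q * w) = Q * w"
      using Q by (simp add: mult.assoc[symmetric] proper_projection_def)
  qed
  have w_eq: "w = P * w + Q * w" by (simp add: Qw)
  have JPQ: "jordan P Q = 0" using PP by (simp add: jordan_def Q_def left_diff_distrib right_diff_distrib)
  have JPy: "jordan P y = y" using y by (simp add: off_diag_def)
  have JxQ: "jordan x Q = x"
    using off_diag_compl[OF x] by (simp add: off_diag_def Q_def jordan_commute[of x])
  have dP: "diag P P" and dQ: "diag Q Q"
    using P Q by (simp_all add: diag_def proper_projection_def)
  have "jordan (P + x) (Q + y) = P * w + (x + y) + Q * w"
    using w_eq by (simp add: jordan_simps(3,4) JPQ JPy JxQ w_def[symmetric] add_ac)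
  then have "f (jordan (P + x) (Q + y)) = f (P * w) + f (x + y) + f (Q * w)"
    using add_peirce[OF P a off_diag_add[OF x y]] b by (simp add: Q_def)
  also have "f (P * w) + f (x + y) + f (Q * w) = f (x + y) + f w"
    using add_diag_diag[OF P a b[unfolded Q_def], folded Q_def] w_eq[symmetric] by simp
  finally have 1: "f (jordan (P + x) (Q + y)) = f (x + y) + f w" .
  \<comment> \<open>The same element evaluated through the Jordan product, where the previous case
    splits both factors; comparison with \<open>1\<close> cancels \<open>f w\<close>.\<close>
  have "f (jordan (P + x) (Q + y)) = d *\<^sub>C jordan (f P + f x) (f Q + f y)"
    using add_diag_off_diag[OF P dP x] add_diag_off_diag[OF Q dQ] off_diag_compl[OF y] in_sa
    by (simp add: jordan self_adjoints_closed Q_def)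
  also have "\<dots> = f (jordan P Q) + f (jordan P y) + f (jordan x Q) + f (jordan x y)"
    using in_sa by (simp add: jordan jordan_simps(3,4) scaleC_add_right add_ac)
  also have "\<dots> = f x + f y + f w" by (simp add: JPQ JPy JxQ zero w_def)
  finally show ?thesis using 1 by simp
qed

text \<open>The preimage \<open>T\<close> lies in the corner because \<open>jordan (1 - P)\<close>
  kills it. Jordan products with off-diagonal \<open>S\<close> move the question to the off-diagonal
  block, where additivity is known, and \<open>diag_faithful\<close> brings the answer back.\<close>

lemma add_diag:
  assumes P: "proper_projection P" and a: "diag P a" and b: "diag P b"
  shows "f (a + b) = f a + f b"
proof -
  note in_sa = diag_in[OF a] diag_in[OF b] proper_projection_in[OF P]
    proper_projection_in[OF proper_projection_compl[OF P]]
  obtain T where T: "T \<in> self_adjoints A" "f T = f a + f b" using closed[OF in_sa(1,2)] by blast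
  have "f (jordan (1 - P) T) = f 0"
    using jordan_add[OF in_sa(4) T(1) in_sa(1,2) T(2)]
    by (simp add: jordan_diag[OF a] jordan_diag[OF b] zero)
  then have "jordan (1 - P) T = 0"
    by (rule inj[rotated 2]) (simp_all add: in_sa T self_adjoints_closed)
  then have T': "diag P T" by (rule diag_jordan_zero[OF P T(1)])
  have y: "diag P (T - (a + b))"
    using T' a b by (simp add: diag_def self_adjoints_closed distrib_left distrib_right
        left_diff_distrib right_diff_distrib)
  have "jordan S (T - (a + b)) = 0" if S: "off_diag P S" for S
  proof -
    note S_in = off_diag_in[OF S]
    have "f (jordan S T) = f (jordan S a) + f (jordan S b)"
      by (rule jordan_add[OF S_in T(1) in_sa(1,2) T(2)])
    also have "\<dots> = f (jordan S (a + b))"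
      using add_off_diag[OF P off_diag_jordan_diag[OF S a] off_diag_jordan_diag[OF S b]]
      by (simp add: jordan_simps)
    finally have "jordan S T = jordan S (a + b)"
      by (rule inj[rotated 2]) (simp_all add: in_sa S_in T self_adjoints_closed)
    then show ?thesis by (simp add: jordan_simps(5))
  qed
  then have "T - (a + b) = 0" by (rule diag_faithful[OF P y])
  then show ?thesis using T by simp
qed

lemma additive_on_self_adjoints:
  assumes X: "X \<in> self_adjoints A" and Y: "Y \<in> self_adjoints A"
  shows "f (X + Y) = f X + f Y"
proof -
  obtain P where P: "proper_projection P" using proper_projection_exists ..
  note P' = proper_projection_compl[OF P]
  obtain a x b where 1: "diag P a" "off_diag P x" "diag (1 - P) b" "X = a + x + b"
    using peirce_decomposition[OF P X] by blast
  obtain a' x' b' where 2: "diag P a'" "off_diag P x'" "diag (1 - P) b'" "Y = a' + x' + b'"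
    using peirce_decomposition[OF P Y] by blast
  have "diag P (a + a')" "diag (1 - P) (b + b')"
    using 1 2 by (simp_all add: diag_def self_adjoints_closed distrib_left distrib_right)
  moreover have "X + Y = (a + a') + (x + x') + (b + b')" by (simp add: 1 2 algebra_simps)
  ultimately have "f (X + Y) = f (a + a') + f (x + x') + f (b + b')"
    using add_peirce[OF P _ off_diag_add[OF 1(2) 2(2)]] by simp
  also have "\<dots> = (f a + f a') + (f x + f x') + (f b + f b')"
    by (simp only: add_diag[OF P 1(1) 2(1)] add_diag[OF P' 1(3) 2(3)] add_off_diag[OF P 1(2) 2(2)])
  also have "\<dots> = (f a + f x + f b) + (f a' + f x' + f b')" by (simp add: add_ac)
  also have "\<dots> = f X + f Y"
    by (simp only: add_peirce[OF P 1(1-3)] add_peirce[OF P 2(1-3)] 1(4) 2(4))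
  finally show ?thesis .
qed

end

section \<open>Mixed skew products\<close>

lemma skew_lie_scalar_left: "[c *\<^sub>C 1, Y]\<^sub>* = (2 * \<i> * of_real (Im c)) *\<^sub>C Y"
proof -
  have "[c *\<^sub>C 1, Y]\<^sub>* = (c - cnj c) *\<^sub>C Y"
    using scaleC_add_left[of "c - cnj c" "cnj c" Y]
    by (simp add: skew_lie_def adj_scaleC scaleC_mult_left scaleC_mult_right eq_diff_eq)
  then show ?thesis by (simp add: complex_diff_cnj mult_ac)
qed

lemma mixed_scalar_left: "[c *\<^sub>C 1, Y]\<^sub>* \<bullet>\<^sub>* Z = (2 * \<i> * of_real (Im c)) *\<^sub>C [Y, Z]\<^sub>*"
  by (simp add: skew_lie_scalar_left skew_jordan_def adj_scaleC scaleC_mult_left scaleC_mult_right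
      skew_lie_def[of Y] scaleC_diff_right)
    (metis add_uminus_conv_diff scaleC_minus1_left scaleC_scaleC mult_minus1)

lemma mixed_scalar_scalar: "[a *\<^sub>C 1, b *\<^sub>C 1]\<^sub>* \<bullet>\<^sub>* Z = of_real (- 4 * Im a * Im b) *\<^sub>C Z"
  by (subst mixed_scalar_left) (simp add: skew_lie_scalar_left scaleC_scaleC mult_ac)

text \<open>A real scalar in the middle slot turns the inner product into a multiple of the
  anti-self-adjoint \<open>X - adj X\<close>, so the outer product becomes a commutator.\<close>

lemma mixed_real_mid:
  "[X, of_real r *\<^sub>C 1]\<^sub>* \<bullet>\<^sub>* Z = of_real r *\<^sub>C ((X - adj X) * Z - Z * (X - adj X))"
  by (simp add: skew_lie_def skew_jordan_def adj_scaleC adj_diff scaleC_mult_left scaleC_mult_right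
      scaleC_diff_right left_diff_distrib right_diff_distrib)

lemma diff_adj_decomposed:
  assumes "adj H = H" "adj K = K"
  shows "H + \<i> *\<^sub>C K - adj (H + \<i> *\<^sub>C K) = (2 * \<i>) *\<^sub>C K"
  unfolding mult_2 scaleC_add_left using assms by (simp add: adj_add adj_scaleC scaleC_minus_left)

text \<open>For self-adjoint \<open>Y\<close> both summands on the right are self-adjoint, so
  additivity on self-adjoint elements can be applied in \<open>f_decompose\<close>.\<close>

lemma skew_lie_decomposed:
  assumes "adj H = H" "adj K = K"
  shows "\<i> *\<^sub>C [H + \<i> *\<^sub>C K, Y]\<^sub>* = \<i> *\<^sub>C (H * Y - Y * H) + - jordan K Y"
  using assms by (simp add: skew_lie_def jordan_def adj_add adj_scaleC distrib_left distrib_right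
      scaleC_mult_left scaleC_mult_right scaleC_add_right scaleC_diff_right scaleC_scaleC
      scaleC_minus_left scaleC_minus_right scaleC_one algebra_simps)

definition double_commutator :: "'a::ring \<Rightarrow> 'a \<Rightarrow> 'a \<Rightarrow> 'a" where
  "double_commutator X Y Z = (X * Y - Y * X) * Z - Z * (X * Y - Y * X)"

lemma jordan_jordan_left_commute:
  "jordan X (jordan Y Z) = jordan Y (jordan X Z) + double_commutator X Y Z"
  by (simp add: jordan_def double_commutator_def algebra_simps)

text \<open>The factors \<open>\<i>\<close> keep iterated commutators of self-adjoint elements
  self-adjoint, the form in which \<open>f_commutator\<close> applies.\<close>

lemma iterated_ii_commutator:
  "\<i> *\<^sub>C ((\<i> *\<^sub>C (X * Y - Y * X)) * Z - Z * (\<i> *\<^sub>C (X * Y - Y * X))) = - double_commutator X Y Z"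
  for X Y Z :: "'h::complex_hilbert bop"
  by (simp add: double_commutator_def scaleC_mult_left scaleC_mult_right scaleC_diff_right[symmetric]
      scaleC_scaleC scaleC_minus1_left)

context von_neumann
begin

lemma skew_lie_in [simp, intro]: "X \<in> A \<Longrightarrow> Y \<in> A \<Longrightarrow> [X, Y]\<^sub>* \<in> A"
  by (simp add: skew_lie_def)

lemma mixed_in [simp, intro]: "X \<in> A \<Longrightarrow> Y \<in> A \<Longrightarrow> Z \<in> A \<Longrightarrow> [X, Y]\<^sub>* \<bullet>\<^sub>* Z \<in> A"
  by (simp add: skew_jordan_def)

lemma self_adjoints_decompose:
  assumes "T \<in> A"
  obtains H K where "H \<in> self_adjoints A" "K \<in> self_adjoints A" "T = H + \<i> *\<^sub>C K"
  by (rule self_adjoint_part_in[OF assms], rule that) (simp_all add: self_adjoints_def)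

end

section \<open>How products and commutators detect scalars\<close>

context nonscalar_factor
begin

lemma one_neq_zero: "(1 :: 'h bop) \<noteq> 0"
proof
  assume "(1 :: 'h bop) = 0"
  then have "T = 0 *\<^sub>C 1" for T :: "'h bop" by (metis mult_1_left mult_zero_left scaleC_zero_left)
  then show False using nonscalar unfolding scalar_operators_def by blast
qed

lemma scalar_inject: "c *\<^sub>C (1 :: 'h bop) = d *\<^sub>C 1 \<longleftrightarrow> c = d"
proof
  assume "c *\<^sub>C (1 :: 'h bop) = d *\<^sub>C 1"
  then have "(c - d) *\<^sub>C (1 :: 'h bop) = 0"
    using scaleC_add_left[of "c - d" d "1 :: 'h bop"] by simp
  then show "c = d" by (simp add: scaleC_eq_0_iff one_neq_zero)
qed simp

lemma central_scalar:
  assumes "Z \<in> A" and "\<And>T. T \<in> A \<Longrightarrow> Z * T = T * Z"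
  shows "\<exists>c. Z = c *\<^sub>C 1"
  using factor assms unfolding factor_def center_def scalar_operators_def by blast

lemma central_scalar_self_adjoints:
  assumes Z: "Z \<in> A" and comm: "\<And>T. T \<in> self_adjoints A \<Longrightarrow> Z * T = T * Z"
  shows "\<exists>c. Z = c *\<^sub>C 1"
proof (rule central_scalar[OF Z])
  fix T assume "T \<in> A"
  then obtain H K where "H \<in> self_adjoints A" "K \<in> self_adjoints A" "T = H + \<i> *\<^sub>C K"
    by (rule self_adjoints_decompose)
  then show "Z * T = T * Z"
    by (simp add: distrib_left distrib_right scaleC_mult_left scaleC_mult_right comm)
qed

lemma nonscalar_self_adjoint: "\<exists>S\<in>self_adjoints A. \<forall>c. S \<noteq> c *\<^sub>C 1"
proof (rule ccontr)
  assume "\<not> ?thesis"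
  then have *: "\<exists>c. S = c *\<^sub>C 1" if "S \<in> self_adjoints A" for S using that by blast
  have "T \<in> scalar_operators" if T: "T \<in> A" for T
  proof -
    obtain H K where "H \<in> self_adjoints A" "K \<in> self_adjoints A" "T = H + \<i> *\<^sub>C K"
      using self_adjoints_decompose[OF T] .
    with * obtain c d where "T = c *\<^sub>C 1 + \<i> *\<^sub>C d *\<^sub>C 1" by metis
    then have "T = (c + \<i> * d) *\<^sub>C 1" by (simp add: scaleC_add_left scaleC_scaleC)
    then show ?thesis unfolding scalar_operators_def by blast
  qed
  then show False using nonscalar by blast
qed

text \<open>If \<open>c\<close> is the commutator of \<open>X\<close> with \<open>Y\<close>, then
  \<open>c X\<close> is the commutator with \<open>Y * X\<close> and must be scalar too: either
  \<open>c = 0\<close> or \<open>X\<close> is itself scalar.\<close>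

lemma scalar_commutator_zero:
  assumes X: "X \<in> A" and Y: "Y \<in> A"
    and scal: "\<And>Y. Y \<in> A \<Longrightarrow> \<exists>c. X * Y - Y * X = c *\<^sub>C 1"
  shows "X * Y = Y * X"
proof -
  obtain c where c: "X * Y - Y * X = c *\<^sub>C 1" using scal[OF Y] by blast
  obtain e where "X * (Y * X) - (Y * X) * X = e *\<^sub>C 1" using scal[OF mult_in[OF Y X]] by blast
  moreover have "X * (Y * X) - (Y * X) * X = (X * Y - Y * X) * X"
    by (simp add: left_diff_distrib mult.assoc)
  ultimately have e: "c *\<^sub>C X = e *\<^sub>C 1" by (simp add: c scaleC_mult_left)
  show ?thesis
  proof (cases "c = 0")
    case True
    then show ?thesis using c by simp
  next
    case False
    then have "X = (e / c) *\<^sub>C 1"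
      using arg_cong[OF e, of "\<lambda>Z. inverse c *\<^sub>C Z"]
      by (simp add: scaleC_scaleC scaleC_one divide_inverse mult.commute)
    then show ?thesis by (simp add: scaleC_mult_left scaleC_mult_right)
  qed
qed

text \<open>\<open>Z = 1\<close> shows that each \<open>[X, Y]\<^sub>*\<close> is anti-self-adjoint,
  whence it commutes with every \<open>Z\<close> and is scalar. In particular
  \<open>X - adj X = c\<close>. A nonzero \<open>c\<close> would make everything commuting with
  \<open>X\<close> scalar, including \<open>X\<close>, and hence all of \<open>A\<close>.\<close>

lemma real_scalar_iff:
  assumes X: "X \<in> A"
  shows "(\<forall>Y\<in>A. \<forall>Z\<in>A. [X, Y]\<^sub>* \<bullet>\<^sub>* Z = 0) \<longleftrightarrow> (\<exists>r. X = of_real r *\<^sub>C 1)"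
proof
  assume *: "\<forall>Y\<in>A. \<forall>Z\<in>A. [X, Y]\<^sub>* \<bullet>\<^sub>* Z = 0"
  have lie: "\<exists>c. [X, Y]\<^sub>* = c *\<^sub>C 1" if Y: "Y \<in> A" for Y
  proof (rule central_scalar)
    define L where "L = [X, Y]\<^sub>*"
    have L: "L * Z + Z * adj L = 0" if "Z \<in> A" for Z
      using * Y that by (simp add: L_def skew_jordan_def)
    have "adj L = - L" using L[OF one_in] by (simp add: add_eq_0_iff)
    then show "[X, Y]\<^sub>* * Z = Z * [X, Y]\<^sub>*" if "Z \<in> A" for Z
      using L[OF that] by (simp add: L_def)
    show "[X, Y]\<^sub>* \<in> A" using X Y by simp
  qed
  obtain c where c: "X - adj X = c *\<^sub>C 1" using lie[OF one_in] by (auto simp: skew_lie_def)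
  then have adjX: "adj X = X - c *\<^sub>C 1" by (simp add: algebra_simps)
  have lie': "[X, Y]\<^sub>* = (X * Y - Y * X) + c *\<^sub>C Y" for Y
    by (simp add: skew_lie_def adjX right_diff_distrib scaleC_mult_right)
  have c0: "c = 0"
  proof (rule ccontr)
    assume "c \<noteq> 0"
    have scal: "\<exists>d. Y = d *\<^sub>C 1" if Y: "Y \<in> A" and comm: "X * Y = Y * X" for Y
    proof -
      obtain e where "c *\<^sub>C Y = e *\<^sub>C 1" using lie[OF Y] lie'[of Y] comm by auto
      then have "inverse c *\<^sub>C c *\<^sub>C Y = inverse c *\<^sub>C e *\<^sub>C 1" by simp
      then show ?thesis using \<open>c \<noteq> 0\<close> by (auto simp: scaleC_scaleC scaleC_one)
    qed
    obtain d where "X = d *\<^sub>C 1" using scal[OF X] by blast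
    then have "\<exists>d. Y = d *\<^sub>C 1" if "Y \<in> A" for Y
      using scal[OF that] by (simp add: scaleC_mult_left scaleC_mult_right)
    then show False using nonscalar unfolding scalar_operators_def by blast
  qed
  have "X * Y = Y * X" if "Y \<in> A" for Y
    by (rule scalar_commutator_zero[OF X that]) (use lie lie' c0 in auto)
  then obtain e where e: "X = e *\<^sub>C 1" using central_scalar[OF X] by blast
  have "e - cnj e = 0"
    using c c0 scaleC_add_left[of "e - cnj e" "cnj e" "1 :: 'h bop"]
    by (simp add: e adj_scaleC scalar_inject)
  then have "e = of_real (Re e)" by (simp add: complex_eq_iff)
  then show "\<exists>r. X = of_real r *\<^sub>C 1" using e by metis
next
  assume "\<exists>r. X = of_real r *\<^sub>C 1"
  then show "\<forall>Y\<in>A. \<forall>Z\<in>A. [X, Y]\<^sub>* \<bullet>\<^sub>* Z = 0" by (auto simp: mixed_scalar_left)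
qed

text \<open>As \<open>X\<close> varies, \<open>X - adj X\<close> reaches \<open>\<i>\<close> times
  every self-adjoint element, so by \<open>mixed_real_mid\<close> the element \<open>Z\<close> is
  central.\<close>

lemma scalar_if_mixed_zero:
  assumes Z: "Z \<in> A" and r: "r \<noteq> 0" and zero: "\<And>X. X \<in> A \<Longrightarrow> [X, of_real r *\<^sub>C 1]\<^sub>* \<bullet>\<^sub>* Z = 0"
  shows "\<exists>c. Z = c *\<^sub>C 1"
proof (rule central_scalar_self_adjoints[OF Z])
  fix S assume S: "S \<in> self_adjoints A"
  define X where "X = (\<i> / 2) *\<^sub>C S"
  have "X - adj X = \<i> *\<^sub>C S"
    using S scaleC_add_left[of "\<i>/2" "\<i>/2" S] scaleC_add_left[of "\<i>/2" "-\<i>/2" S]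
    by (simp add: X_def self_adjoints_def adj_scaleC eq_neg_iff_add_eq_0)
      (metis add.commute diff_conv_add_uminus eq_neg_iff_add_eq_0)
  moreover have "X \<in> A" using S by (auto simp: X_def self_adjoints_def)
  then have "(X - adj X) * Z - Z * (X - adj X) = 0"
    using zero[of X] r by (simp add: mixed_real_mid scaleC_eq_0_iff)
  ultimately have "\<i> *\<^sub>C (S * Z - Z * S) = 0"
    by (simp add: scaleC_mult_left scaleC_mult_right scaleC_diff_right)
  then show "Z * S = S * Z" by (simp add: scaleC_eq_0_iff)
qed

lemma noncommuting_self_adjoints:
  "\<exists>X\<in>self_adjoints A. \<exists>Y\<in>self_adjoints A. X * Y \<noteq> Y * X"
proof -
  obtain S where S: "S \<in> self_adjoints A" "\<And>c. S \<noteq> c *\<^sub>C 1" using nonscalar_self_adjoint by blast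
  then show ?thesis
    using central_scalar_self_adjoints[of S] by (auto simp: self_adjoints_def)
qed

text \<open>Otherwise all commutators of self-adjoint elements would be central, hence scalar, and
  \<open>scalar_commutator_zero\<close> would make them vanish.\<close>

lemma nonvanishing_double_commutator:
  "\<exists>X\<in>self_adjoints A. \<exists>Y\<in>self_adjoints A. \<exists>Z\<in>self_adjoints A.
     (X * Y - Y * X) * Z - Z * (X * Y - Y * X) \<noteq> 0"
proof (rule ccontr)
  assume "\<not> ?thesis"
  then have *: "(X * Y - Y * X) * Z = Z * (X * Y - Y * X)"
    if "X \<in> self_adjoints A" "Y \<in> self_adjoints A" "Z \<in> self_adjoints A" for X Y Z
    using that by auto
  obtain X Y where XY: "X \<in> self_adjoints A" "Y \<in> self_adjoints A" "X * Y \<noteq> Y * X"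
    using noncommuting_self_adjoints by blast
  have "X * Z = Z * X" if Z: "Z \<in> A" for Z
  proof (rule scalar_commutator_zero[OF _ Z])
    show X: "X \<in> A" using XY by (simp add: self_adjoints_def)
    fix W assume "W \<in> A"
    then obtain H K where HK: "H \<in> self_adjoints A" "K \<in> self_adjoints A" "W = H + \<i> *\<^sub>C K"
      by (rule self_adjoints_decompose)
    have "\<exists>c. X * S - S * X = c *\<^sub>C 1" if "S \<in> self_adjoints A" for S
      by (rule central_scalar_self_adjoints)
        (use * XY that X in \<open>auto simp: self_adjoints_def\<close>)
    then obtain c d where "X * H - H * X = c *\<^sub>C 1" "X * K - K * X = d *\<^sub>C 1" using HK by metis
    moreover have "X * W - W * X = (X * H - H * X) + \<i> *\<^sub>C (X * K - K * X)"
      by (simp add: HK distrib_left distrib_right scaleC_mult_left scaleC_mult_right scaleC_diff_right)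
    ultimately have "X * W - W * X = (c + \<i> * d) *\<^sub>C 1" by (simp add: scaleC_add_left scaleC_scaleC)
    then show "\<exists>c. X * W - W * X = c *\<^sub>C 1" ..
  qed
  then show False using XY by (simp add: self_adjoints_def)
qed

end

text \<open>On scalars the mixed product is symmetric in the first two slots. Pulled back to
  \<open>A\<close>, the symmetry with \<open>1\<close> in one of them makes
  \<open>[X, 1]\<^sub>* \<bullet>\<^sub>* Z\<close> vanish, so every \<open>Z\<close> would be
  scalar.\<close>

lemma mixed_codomain_nonscalar:
  assumes A: "nonscalar_factor A" and bij: "bij_betw f A B"
    and hom: "\<And>X Y Z. X \<in> A \<Longrightarrow> Y \<in> A \<Longrightarrow> Z \<in> A \<Longrightarrow>
      f ([X, Y]\<^sub>* \<bullet>\<^sub>* Z) = [f X, f Y]\<^sub>* \<bullet>\<^sub>* f Z"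
  shows "\<not> B \<subseteq> scalar_operators"
proof
  assume B: "B \<subseteq> scalar_operators"
  interpret nonscalar_factor A by (rule A)
  have sym: "[X, Y]\<^sub>* \<bullet>\<^sub>* Z = [Y, X]\<^sub>* \<bullet>\<^sub>* Z" if "X \<in> A" "Y \<in> A" "Z \<in> A" for X Y Z
  proof -
    have "f X \<in> B" "f Y \<in> B" using bij that bij_betwE by blast+
    then obtain a b where "f X = a *\<^sub>C 1" "f Y = b *\<^sub>C 1"
      using B unfolding scalar_operators_def by blast
    then have "f ([X, Y]\<^sub>* \<bullet>\<^sub>* Z) = f ([Y, X]\<^sub>* \<bullet>\<^sub>* Z)"
      using that by (simp add: hom mixed_scalar_scalar mult_ac)
    then show ?thesis
      using bij that by (meson bij_betw_imp_inj_on inj_onD mixed_in)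
  qed
  have "\<exists>c. Z = c *\<^sub>C 1" if Z: "Z \<in> A" for Z
  proof (rule scalar_if_mixed_zero[OF Z, of 1])
    fix X assume "X \<in> A"
    then show "[X, complex_of_real 1 *\<^sub>C 1]\<^sub>* \<bullet>\<^sub>* Z = 0"
      using sym[of X "of_real 1 *\<^sub>C 1" Z] Z mixed_scalar_left[of "of_real 1" X Z] by simp
  qed simp
  then show False using nonscalar unfolding scalar_operators_def by blast
qed

section \<open>Bijections preserving the mixed product\<close>

text \<open>Squares go to squares, so \<open>m\<close> is monotone; it fixes the rationals, which
  are dense.\<close>

lemma real_multiplicative_additive_id:
  fixes m :: "real \<Rightarrow> real"
  assumes one: "m 1 = 1" and add: "\<And>x y. m (x + y) = m x + m y" and mult: "\<And>x y. m (x * y) = m x * m y"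
  shows "m x = x"
proof -
  have zero: "m 0 = 0" using add[of 0 0] by simp
  have minus: "m (- x) = - m x" for x using add[of x "- x"] zero by simp
  have nat: "m (of_nat n) = of_nat n" for n by (induction n) (simp_all add: zero one add)
  have int: "m (of_int k) = of_int k" for k
    by (cases k rule: int_cases2) (simp_all add: nat minus)
  have rat: "m (of_rat q) = of_rat q" for q
  proof -
    obtain a b where q: "quotient_of q = (a, b)" by force
    then have b: "b > 0" by (rule quotient_of_denom_pos)
    have "of_rat q = real_of_int a / real_of_int b"
      by (simp add: quotient_of_div[OF q] of_rat_divide)
    then have "of_rat q * real_of_int b = real_of_int a" using b by simp
    then have "m (of_rat q) * real_of_int b = of_rat q * real_of_int b"
      using mult[of "of_rat q" "of_int b"] \<open>of_rat q * real_of_int b = real_of_int a\<close> int by metis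
    then show ?thesis using b by auto
  qed
  have nonneg: "0 \<le> m x" if "0 \<le> x" for x
    using mult[of "sqrt x" "sqrt x"] that by (simp add: real_sqrt_mult_self)
  have mono: "m x \<le> m y" if "x \<le> y" for x y
    using nonneg[of "y - x"] add[of "y - x" x] that by simp
  show ?thesis
  proof (rule ccontr)
    assume "m x \<noteq> x"
    then consider "m x < x" | "x < m x" by linarith
    then show False
    proof cases
      case 1
      then obtain q where "m x < of_rat q" "of_rat q < x" using of_rat_dense by blast
      then show False using mono[of "of_rat q" x] rat by simp
    next
      case 2
      then obtain q where "x < of_rat q" "of_rat q < m x" using of_rat_dense by blast
      then show False using mono[of x "of_rat q"] rat by simp
    qed
  qed
qed

locale mixed_map = A: nonscalar_factor A + B: nonscalar_factor B
  for A :: "'h::complex_hilbert bop set" and B :: "'k::complex_hilbert bop set" +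
  fixes f :: "'h bop \<Rightarrow> 'k bop"
  assumes bij: "bij_betw f A B"
    and hom: "\<And>X Y Z. X \<in> A \<Longrightarrow> Y \<in> A \<Longrightarrow> Z \<in> A \<Longrightarrow>
      f ([X, Y]\<^sub>* \<bullet>\<^sub>* Z) = [f X, f Y]\<^sub>* \<bullet>\<^sub>* f Z"
begin

lemma f_in [simp, intro]: "X \<in> A \<Longrightarrow> f X \<in> B"
  using bij bij_betwE by blast

lemma f_inject: "X \<in> A \<Longrightarrow> Y \<in> A \<Longrightarrow> f X = f Y \<longleftrightarrow> X = Y"
  using bij by (metis bij_betw_imp_inj_on inj_on_eq_iff)

lemma f_surj: "Y \<in> B \<Longrightarrow> \<exists>X\<in>A. f X = Y"
  using bij by (metis bij_betw_imp_surj_on imageE)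

lemma f_zero [simp]: "f 0 = 0"
proof -
  \<comment> \<open>A preimage of 0 in the second slot makes the image product vanish whatever
    \<open>f 0\<close> is.\<close>
  obtain X where X: "X \<in> A" "f X = 0" using f_surj[OF B.zero_in] by blast
  have "f ([0, X]\<^sub>* \<bullet>\<^sub>* 0) = 0"
    using hom[of 0 X 0] X by (simp add: skew_lie_def skew_jordan_def)
  then show ?thesis by (simp add: skew_lie_def skew_jordan_def)
qed

lemma f_eq_0_iff: "X \<in> A \<Longrightarrow> f X = 0 \<longleftrightarrow> X = 0"
  using f_inject[of X 0] by simp

lemma f_real_scalar:
  assumes X: "X \<in> A"
  shows "(\<exists>r. f X = of_real r *\<^sub>C 1) \<longleftrightarrow> (\<exists>r. X = of_real r *\<^sub>C 1)"
proof -
  have "(\<forall>Y\<in>B. \<forall>Z\<in>B. [f X, Y]\<^sub>* \<bullet>\<^sub>* Z = 0) \<longleftrightarrow> (\<forall>Y\<in>A. \<forall>Z\<in>A. [f X, f Y]\<^sub>* \<bullet>\<^sub>* f Z = 0)"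
    using f_surj f_in by metis
  also have "\<dots> \<longleftrightarrow> (\<forall>Y\<in>A. \<forall>Z\<in>A. [X, Y]\<^sub>* \<bullet>\<^sub>* Z = 0)"
    using X by (simp add: hom[symmetric] f_eq_0_iff)
  finally show ?thesis by (simp add: A.real_scalar_iff B.real_scalar_iff X f_in)
qed

section \<open>The action on scalars and the constants attached to \<open>f\<close>\<close>

definition scal :: "complex \<Rightarrow> complex" where
  "scal c = (THE z. f (c *\<^sub>C 1) = z *\<^sub>C 1)"

definition p :: real where "p = Re (scal 1)"

definition m :: "real \<Rightarrow> real" where "m u = Re (scal (of_real u)) / p"

lemma scalI: "f (c *\<^sub>C 1) = z *\<^sub>C 1 \<Longrightarrow> scal c = z"
  unfolding scal_def by (rule the_equality) (auto simp: B.scalar_inject)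

lemma f_one: "f 1 = of_real p *\<^sub>C 1" and p_nonzero: "p \<noteq> 0"
proof -
  obtain r where r: "f 1 = of_real r *\<^sub>C 1"
    using f_real_scalar[OF A.one_in] scaleC_one[of "1::'h bop"] by (metis of_real_1)
  then have "scal 1 = of_real r" by (intro scalI) (simp add: scaleC_one)
  then show f1: "f 1 = of_real p *\<^sub>C 1" using r by (simp add: p_def)
  show "p \<noteq> 0" using f1 f_eq_0_iff[OF A.one_in] A.one_neq_zero by auto
qed

text \<open>A scalar in the last slot is annihilated when \<open>1\<close> stands in the middle.
  This carries over to \<open>B\<close> with \<open>f 1 = p\<close> in the middle, where
  \<open>scalar_if_mixed_zero\<close> recognises scalars.\<close>

lemma f_scalar: "f (c *\<^sub>C 1) = scal c *\<^sub>C 1"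
proof -
  have "\<exists>z. f (c *\<^sub>C 1) = z *\<^sub>C 1"
  proof (rule B.scalar_if_mixed_zero[OF _ p_nonzero])
    fix X assume "X \<in> B"
    then obtain X' where X': "X' \<in> A" "f X' = X" using f_surj by blast
    have "[X', 1]\<^sub>* \<bullet>\<^sub>* (c *\<^sub>C 1) = 0"
      using mixed_real_mid[of X' 1 "c *\<^sub>C 1"] by (simp add: scaleC_one scaleC_mult_left scaleC_mult_right)
    then show "[X, of_real p *\<^sub>C 1]\<^sub>* \<bullet>\<^sub>* f (c *\<^sub>C 1) = 0"
      using hom[of X' 1 "c *\<^sub>C 1"] X' by (simp add: f_one)
  qed auto
  then show ?thesis using scalI by metis
qed

lemma Im_scal_ii: "Im (scal \<i>) \<noteq> 0"
proof
  assume "Im (scal \<i>) = 0"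
  then have "f (\<i> *\<^sub>C 1) = of_real (Re (scal \<i>)) *\<^sub>C 1"
    unfolding f_scalar by (simp add: B.scalar_inject complex_eq_iff)
  then obtain r where "\<i> *\<^sub>C (1::'h bop) = of_real r *\<^sub>C 1" using f_real_scalar[of "\<i> *\<^sub>C 1"] by blast
  then show False by (simp add: A.scalar_inject complex_eq_iff)
qed

lemma f_mixed_scalars:
  assumes "Z \<in> A"
  shows "f (of_real (- 4 * Im a * Im b) *\<^sub>C Z) = of_real (- 4 * Im (scal a) * Im (scal b)) *\<^sub>C f Z"
  using hom[of "a *\<^sub>C 1" "b *\<^sub>C 1" Z] assms by (simp only: mixed_scalar_scalar f_scalar) simp

lemma f_scaleR:
  assumes "Z \<in> A"
  shows "f (of_real u *\<^sub>C Z) = of_real (m u) *\<^sub>C f Z"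
proof -
  \<comment> \<open>Chosen so that \<open>-4 * Im a * Im b = u\<close> for \<open>a = \<i>\<close>
    and the other scalar as \<open>b\<close>; the resulting factor \<open>v\<close> is the same for
    all \<open>Z\<close>.\<close>
  define v where "v = - 4 * Im (scal \<i>) * Im (scal (\<i> * of_real (- u / 4)))"
  have v: "f (of_real u *\<^sub>C Z) = of_real v *\<^sub>C f Z" if "Z \<in> A" for Z
    using f_mixed_scalars[OF that, of \<i> "\<i> * of_real (- u / 4)"] by (simp add: v_def)
  have "scal (of_real u) = of_real (v * p)"
    by (rule scalI) (simp add: v f_one scaleC_scaleC)
  then have "m u = v" using p_nonzero by (simp add: m_def)
  then show ?thesis using v[OF assms] by simp
qed

lemma m_eqI: "f (of_real u *\<^sub>C 1) = of_real (v * p) *\<^sub>C 1 \<Longrightarrow> m u = v"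
  using f_scaleR[OF A.one_in, of u] p_nonzero
  by (simp add: f_one scaleC_scaleC B.scalar_inject flip: of_real_mult)

lemma m_one: "m 1 = 1"
  by (rule m_eqI) (simp add: f_one scaleC_one)

lemma m_mult: "m (u * v) = m u * m v"
proof (rule m_eqI)
  have "f (of_real u *\<^sub>C of_real v *\<^sub>C 1) = of_real (m u) *\<^sub>C of_real (m v) *\<^sub>C f 1"
    by (simp add: f_scaleR)
  then show "f (of_real (u * v) *\<^sub>C 1) = of_real (m u * m v * p) *\<^sub>C 1"
    by (simp add: scaleC_scaleC f_one mult.assoc)
qed

lemma m_minus_one: "m (-1) = -1"
proof -
  have "(m (-1))\<^sup>2 = 1" using m_mult[of "-1" "-1"] by (simp add: m_one power2_eq_square)
  moreover have "m (-1) \<noteq> 1"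
  proof
    assume "m (-1) = 1"
    then have "f (of_real (-1) *\<^sub>C 1) = f (of_real 1 *\<^sub>C 1)"
      using f_scaleR[of 1 "-1"] f_scaleR[of 1 1] by (simp add: m_one)
    then show False
      using f_inject[of "of_real (-1) *\<^sub>C 1" "of_real 1 *\<^sub>C 1"] A.scalar_inject[of "of_real (-1)" "of_real 1"]
      by (simp del: of_real_1 of_real_minus)
  qed
  ultimately show ?thesis by (simp add: power2_eq_1_iff)
qed

lemma f_minus: "Z \<in> A \<Longrightarrow> f (- Z) = - f Z"
  using f_scaleR[of Z "-1"] by (simp add: m_minus_one scaleC_minus1_left)

lemma m_2_nonzero: "m 2 \<noteq> 0"
  using m_mult[of 2 "1/2"] by (auto simp: m_one)

text \<open>Putting \<open>\<i>\<close> into the first slot produces the factor 2 on the left and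
  \<open>2 * Im (scal \<i>)\<close> on the right; as long as additivity is unknown, the left factor
  leaves \<open>f\<close> as \<open>m 2\<close>.\<close>

definition \<eta> :: real where "\<eta> = 2 * Im (scal \<i>) / m 2"

lemma f_skew_lie:
  assumes "Y \<in> A" "Z \<in> A"
  shows "f (\<i> *\<^sub>C [Y, Z]\<^sub>*) = (\<i> * of_real \<eta>) *\<^sub>C [f Y, f Z]\<^sub>*"
proof -
  have "f (of_real 2 *\<^sub>C \<i> *\<^sub>C [Y, Z]\<^sub>*) = (2 * \<i> * of_real (Im (scal \<i>))) *\<^sub>C [f Y, f Z]\<^sub>*"
    using hom[of "\<i> *\<^sub>C 1" Y Z] assms by (simp add: mixed_scalar_left f_scalar scaleC_scaleC)
  then have "of_real (m 2) *\<^sub>C f (\<i> *\<^sub>C [Y, Z]\<^sub>*) = (2 * \<i> * of_real (Im (scal \<i>))) *\<^sub>C [f Y, f Z]\<^sub>*"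
    using assms by (simp only: f_scaleR A.scaleC_in A.skew_lie_in)
  then have "of_real (1 / m 2) *\<^sub>C of_real (m 2) *\<^sub>C f (\<i> *\<^sub>C [Y, Z]\<^sub>*) =
      of_real (1 / m 2) *\<^sub>C (2 * \<i> * of_real (Im (scal \<i>))) *\<^sub>C [f Y, f Z]\<^sub>*" by simp
  then show ?thesis using m_2_nonzero by (simp add: scaleC_scaleC scaleC_one \<eta>_def mult_ac)
qed

text \<open>Evaluate \<open>f_skew_lie\<close> at the scalars \<open>\<i>\<close> and
  \<open>1\<close>, where \<open>\<i> *\<^sub>C [\<i> *\<^sub>C 1, 1]\<^sub>*\<close> is -2.
  Together with the definition of \<open>\<eta>\<close> this says that \<open>\<eta>\<close> is its
  own inverse.\<close>

lemma m_2: "m 2 = 2 * Im (scal \<i>) * \<eta>"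
proof -
  have coef: "\<i> * (2 * \<i> * of_real (Im \<i>)) = of_real (-1) * of_real 2" by (simp add: complex_eq_iff)
  have "f (\<i> *\<^sub>C [\<i> *\<^sub>C 1, 1]\<^sub>*) = f (of_real (-1) *\<^sub>C of_real 2 *\<^sub>C 1)"
    by (simp only: skew_lie_scalar_left scaleC_scaleC coef)
  then have "(\<i> * of_real \<eta>) *\<^sub>C [scal \<i> *\<^sub>C 1, f 1]\<^sub>* = (- of_real (m 2)) *\<^sub>C f 1"
    by (simp only: f_skew_lie f_scalar[of \<i>] f_scaleR A.one_in A.scaleC_in m_minus_one) (simp add: scaleC_scaleC)
  then have "\<i> * of_real \<eta> * (2 * \<i> * of_real (Im (scal \<i>))) * of_real p = (- of_real (m 2)) * of_real p"
    by (simp add: skew_lie_scalar_left f_one scaleC_scaleC B.scalar_inject mult.assoc)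
  then have "- (of_real (2 * Im (scal \<i>) * \<eta> * p) :: complex) = - of_real (m 2 * p)"
    by (simp add: mult_ac)
  then show ?thesis using p_nonzero by (simp del: of_real_mult)
qed

lemma eta_cases: "\<eta> = 1 \<or> \<eta> = -1"
proof -
  have "\<eta>\<^sup>2 = 1" using m_2 m_2_nonzero by (simp add: \<eta>_def power2_eq_square field_simps Im_scal_ii)
  then show ?thesis by (simp add: power2_eq_1_iff)
qed

lemma eta_sq: "\<eta> * \<eta> = 1"
  using eta_cases by auto

text \<open>The only possible Jordan factor: \<open>jordan 1 1 = 2\<close> requires
  \<open>m 2 * p = d * (2 * p * p)\<close>.\<close>

definition d :: real where "d = m 2 / (2 * p)"

lemma d_nonzero: "d \<noteq> 0"
  using m_2_nonzero p_nonzero by (simp add: d_def)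

lemma Im_scal_ii_eq: "Im (scal \<i>) = \<eta> * d * p"
  using m_2 p_nonzero eta_sq by (simp add: d_def field_simps)

section \<open>Self-adjoint elements, their commutators and Jordan products\<close>

lemma f_im:
  assumes "X \<in> A"
  shows "f (\<i> *\<^sub>C (X - adj X)) = (\<i> * of_real (\<eta> * p)) *\<^sub>C (f X - adj (f X))"
  using f_skew_lie[OF assms A.one_in]
  by (simp add: skew_lie_def f_one scaleC_mult_left scaleC_mult_right scaleC_diff_right[symmetric] scaleC_scaleC
      mult.assoc)

lemma im_surj:
  assumes "K \<in> self_adjoints A"
  obtains X where "X \<in> A" "\<i> *\<^sub>C (X - adj X) = K"
proof
  let ?X = "(- \<i> / 2) *\<^sub>C K"
  show "?X \<in> A" using assms by (auto simp: self_adjoints_def)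
  have "\<i> *\<^sub>C ?X - \<i> *\<^sub>C adj ?X = (1/2) *\<^sub>C K - (-1) *\<^sub>C (1/2) *\<^sub>C K"
    using assms by (simp add: self_adjoints_def adj_scaleC scaleC_scaleC)
  also have "\<dots> = (1/2 + 1/2) *\<^sub>C K" unfolding scaleC_minus1_left scaleC_add_left by simp
  finally show "\<i> *\<^sub>C (?X - adj ?X) = K" by (simp add: scaleC_diff_right scaleC_one)
qed

text \<open>Both directions rest on \<open>f_im\<close>: its left side vanishes exactly for
  self-adjoint \<open>X\<close>, and by \<open>im_surj\<close> every self-adjoint element occurs
  there, while the right side is always self-adjoint.\<close>

lemma f_self_adjoint_iff:
  assumes X: "X \<in> A"
  shows "f X \<in> self_adjoints B \<longleftrightarrow> X \<in> self_adjoints A"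
proof
  assume "f X \<in> self_adjoints B"
  then have "f (\<i> *\<^sub>C (X - adj X)) = 0" using f_im[OF X] by (simp add: self_adjoints_def scaleC_zero_right)
  then show "X \<in> self_adjoints A"
    using X f_eq_0_iff[of "\<i> *\<^sub>C (X - adj X)"] by (auto simp: self_adjoints_def scaleC_eq_0_iff)
next
  assume "X \<in> self_adjoints A"
  then obtain Y where Y: "Y \<in> A" "\<i> *\<^sub>C (Y - adj Y) = X" by (rule im_surj)
  have "adj ((\<i> * of_real (\<eta> * p)) *\<^sub>C (f Y - adj (f Y))) = (\<i> * of_real (\<eta> * p)) *\<^sub>C (f Y - adj (f Y))"
    by (simp add: adj_scaleC adj_diff scaleC_minus_left scaleC_diff_right)
  then show "f X \<in> self_adjoints B"
    using f_im[OF Y(1)] X by (simp add: Y self_adjoints_def)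
qed

lemma f_self_adjoint: "X \<in> self_adjoints A \<Longrightarrow> f X \<in> self_adjoints B"
  using f_self_adjoint_iff by (auto simp: self_adjoints_def)

lemma f_self_adjoint_surj: "Y \<in> self_adjoints B \<Longrightarrow> \<exists>X\<in>self_adjoints A. f X = Y"
  using f_surj[of Y] f_self_adjoint_iff by (auto simp: self_adjoints_def)

lemma self_adjoints_D: "X \<in> self_adjoints A \<Longrightarrow> X \<in> A" "X \<in> self_adjoints A \<Longrightarrow> adj X = X"
  "X \<in> self_adjoints A \<Longrightarrow> adj (f X) = f X"
  using f_self_adjoint[of X] by (simp_all add: self_adjoints_def)

text \<open>Writing \<open>K\<close> as \<open>[X, \<i> *\<^sub>C 1]\<^sub>*\<close> makes
  \<open>\<i> *\<^sub>C K\<close> accessible to \<open>f_skew_lie\<close>, with the scalar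
  \<open>\<i>\<close> in the second slot.\<close>

lemma f_ii_self_adjoint_scal:
  assumes K: "K \<in> self_adjoints A"
  shows "f (\<i> *\<^sub>C K) = (scal \<i> / of_real p) *\<^sub>C f K"
proof -
  obtain X where X: "X \<in> A" "\<i> *\<^sub>C (X - adj X) = K" using im_surj[OF K] .
  have "[X, \<i> *\<^sub>C 1]\<^sub>* = K"
    by (simp add: skew_lie_def scaleC_mult_left scaleC_mult_right scaleC_diff_right[symmetric] X)
  then have "f (\<i> *\<^sub>C K) = (\<i> * of_real \<eta>) *\<^sub>C [f X, scal \<i> *\<^sub>C 1]\<^sub>*"
    using f_skew_lie[OF X(1), of "\<i> *\<^sub>C 1"] by (simp add: f_scalar)
  also have "\<dots> = (scal \<i> / of_real p) *\<^sub>C (\<i> * of_real (\<eta> * p)) *\<^sub>C (f X - adj (f X))"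
    using p_nonzero by (simp add: skew_lie_def scaleC_mult_left scaleC_mult_right
        scaleC_diff_right[symmetric] scaleC_scaleC mult_ac)
  finally show ?thesis using f_im[OF X(1)] X(2) by simp
qed

lemma skew_lie_self_adjoint:
  assumes "X \<in> self_adjoints A"
  shows "[X, Y]\<^sub>* = X * Y - Y * X" "[\<i> *\<^sub>C X, Y]\<^sub>* = \<i> *\<^sub>C jordan X Y"
    "[f X, Y']\<^sub>* = f X * Y' - Y' * f X"
  using assms
  by (simp_all add: skew_lie_def jordan_def self_adjoints_D adj_scaleC scaleC_mult_left
      scaleC_mult_right scaleC_add_right scaleC_minus_left)

lemma f_commutator:
  assumes "X \<in> self_adjoints A" "Y \<in> self_adjoints A"
  shows "f (\<i> *\<^sub>C (X * Y - Y * X)) = (\<i> * of_real \<eta>) *\<^sub>C (f X * f Y - f Y * f X)"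
  using f_skew_lie[of X Y] assms by (simp add: skew_lie_self_adjoint self_adjoints_D)

text \<open>Since \<open>jordan X Y\<close> is symmetric in \<open>X\<close> and \<open>Y\<close>, so is its image
  \<open>- \<i> \<eta> (c f(X) f(Y) - cnj c f(Y) f(X))\<close> with \<open>c = scal \<i> / p\<close>.\<close>

lemma scal_ii: "scal \<i> = \<i> * of_real (\<eta> * d * p)"
proof -
  define c where "c = scal \<i> / of_real p"
  have J: "f (- jordan X Y) = (\<i> * of_real \<eta>) *\<^sub>C (c *\<^sub>C (f X * f Y) - cnj c *\<^sub>C (f Y * f X))"
    if XY: "X \<in> self_adjoints A" "Y \<in> self_adjoints A" for X Y
  proof -
    have "\<i> *\<^sub>C [\<i> *\<^sub>C X, Y]\<^sub>* = - jordan X Y"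
      using XY by (simp add: skew_lie_self_adjoint scaleC_scaleC scaleC_minus1_left)
    then show ?thesis
      using f_skew_lie[of "\<i> *\<^sub>C X" Y] XY
      by (simp add: f_ii_self_adjoint_scal c_def[symmetric] self_adjoints_D skew_lie_def[of _ "f Y"]
          adj_scaleC scaleC_mult_left scaleC_mult_right)
  qed
  obtain X Y where XY: "X \<in> self_adjoints A" "Y \<in> self_adjoints A" "X * Y \<noteq> Y * X"
    using A.noncommuting_self_adjoints by blast
  define D where "D = f X * f Y - f Y * f X"
  have "f (\<i> *\<^sub>C (X * Y - Y * X)) \<noteq> 0"
    using XY by (subst f_eq_0_iff) (auto simp: scaleC_eq_0_iff self_adjoints_D)
  then have "D \<noteq> 0" unfolding f_commutator[OF XY(1,2)] D_def by (metis scaleC_zero_right)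
  have "(\<i> * of_real \<eta>) *\<^sub>C (c *\<^sub>C (f X * f Y) - cnj c *\<^sub>C (f Y * f X)) =
      (\<i> * of_real \<eta>) *\<^sub>C (c *\<^sub>C (f Y * f X) - cnj c *\<^sub>C (f X * f Y))"
    using J[OF XY(1,2)] J[OF XY(2,1)] by (simp add: jordan_commute[of X])
  then have "(\<i> * of_real \<eta>) *\<^sub>C ((c *\<^sub>C (f X * f Y) - cnj c *\<^sub>C (f Y * f X)) -
      (c *\<^sub>C (f Y * f X) - cnj c *\<^sub>C (f X * f Y))) = 0"
    by (simp only: scaleC_diff_right) simp
  then have "(c *\<^sub>C (f X * f Y) - cnj c *\<^sub>C (f Y * f X)) -
      (c *\<^sub>C (f Y * f X) - cnj c *\<^sub>C (f X * f Y)) = 0"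
    using eta_cases by (auto simp: scaleC_eq_0_iff)
  moreover have "(c *\<^sub>C (f X * f Y) - cnj c *\<^sub>C (f Y * f X)) -
      (c *\<^sub>C (f Y * f X) - cnj c *\<^sub>C (f X * f Y)) = (c + cnj c) *\<^sub>C D"
    by (simp add: D_def scaleC_diff_right scaleC_add_left)
  ultimately have "c + cnj c = 0" using \<open>D \<noteq> 0\<close> by (simp add: scaleC_eq_0_iff)
  then have "Re c = 0" by (simp add: complex_add_cnj)
  then have "Re (scal \<i>) = 0" using p_nonzero by (simp add: c_def)
  then show ?thesis using Im_scal_ii_eq by (simp add: complex_eq_iff)
qed

lemma f_ii_self_adjoint:
  assumes "K \<in> self_adjoints A"
  shows "f (\<i> *\<^sub>C K) = (\<i> * of_real (\<eta> * d)) *\<^sub>C f K"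
  using f_ii_self_adjoint_scal[OF assms] p_nonzero by (simp add: scal_ii)

text \<open>The Jordan product is a skew Lie product in disguise,
  \<open>\<i> *\<^sub>C [\<i> *\<^sub>C S, Y]\<^sub>* = - jordan S Y\<close>. Here \<open>Y\<close>
  ranges over all of \<open>A\<close> because \<open>f_decompose\<close> takes
  \<open>Y = H + \<i> K\<close>.\<close>

lemma f_jordan:
  assumes S: "S \<in> self_adjoints A" and Y: "Y \<in> A"
  shows "f (jordan S Y) = of_real d *\<^sub>C jordan (f S) (f Y)"
proof -
  have "\<i> *\<^sub>C [\<i> *\<^sub>C S, Y]\<^sub>* = - jordan S Y"
    using S by (simp add: skew_lie_self_adjoint scaleC_scaleC scaleC_minus1_left)
  then have "f (- jordan S Y) = (\<i> * of_real \<eta>) *\<^sub>C [(\<i> * of_real (\<eta> * d)) *\<^sub>C f S, f Y]\<^sub>*"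
    using f_skew_lie[of "\<i> *\<^sub>C S" Y] S Y by (simp add: f_ii_self_adjoint self_adjoints_D)
  also have "[(\<i> * of_real (\<eta> * d)) *\<^sub>C f S, f Y]\<^sub>* = (\<i> * of_real (\<eta> * d)) *\<^sub>C jordan (f S) (f Y)"
    using S by (simp add: skew_lie_def jordan_def self_adjoints_D adj_scaleC scaleC_mult_left
        scaleC_mult_right scaleC_add_right scaleC_minus_left)
  also have "(\<i> * of_real \<eta>) *\<^sub>C (\<i> * of_real (\<eta> * d)) *\<^sub>C jordan (f S) (f Y) =
      (- of_real ((\<eta> * \<eta>) * d)) *\<^sub>C jordan (f S) (f Y)"
    by (simp add: scaleC_scaleC mult_ac)
  finally have "- f (jordan S Y) = - (of_real d *\<^sub>C jordan (f S) (f Y))"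
    using S Y f_minus[of "jordan S Y"] scaleC_scaleC[of "-1" "of_real d" "jordan (f S) (f Y)"]
    by (simp add: eta_sq jordan_def self_adjoints_D scaleC_minus1_left)
  then show ?thesis by simp
qed

section \<open>Additivity and the splitting into real and imaginary parts\<close>

sublocale jordan_map A f "of_real d"
proof
  fix X Y assume XY: "X \<in> self_adjoints A" "Y \<in> self_adjoints A"
  show "f (jordan X Y) = of_real d *\<^sub>C jordan (f X) (f Y)"
    using f_jordan XY self_adjoints_D by blast
  show "X = Y" if "f X = f Y" using that f_inject XY self_adjoints_D by blast
  show "\<exists>T\<in>self_adjoints A. f T = f X + f Y"
    using f_self_adjoint_surj B.self_adjoints_closed(3) f_self_adjoint XY by blast
qed simp

lemma m_add: "m (u + v) = m u + m v"
proof (rule m_eqI)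
  have "f (of_real u *\<^sub>C 1 + of_real v *\<^sub>C 1) = f (of_real u *\<^sub>C 1) + f (of_real v *\<^sub>C 1)"
    by (rule additive_on_self_adjoints) (simp_all add: A.self_adjoints_closed)
  then show "f (of_real (u + v) *\<^sub>C 1) = of_real ((m u + m v) * p) *\<^sub>C 1"
    by (simp add: f_scaleR f_one scaleC_scaleC scaleC_add_left[symmetric] distrib_right)
qed

text \<open>Additivity on real multiples of \<open>1\<close> makes \<open>m\<close> a ring
  endomorphism of the reals; up to here \<open>f\<close> was homogeneous only up to
  \<open>m\<close>.\<close>

lemma m_id: "m u = u"
  by (rule real_multiplicative_additive_id[OF m_one m_add m_mult])

lemma d_eq: "d = 1 / p"
  by (simp add: d_def m_id)

text \<open>Write the image as \<open>R + \<i> L\<close>. The formula \<open>f_im\<close> yields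
  \<open>L\<close>, and commutators with self-adjoint elements show that \<open>R - f H\<close> is
  central, a scalar \<open>r\<close>. The same holds for \<open>jordan S (H + \<i> K)\<close>;
  comparing both, twice \<open>r\<close> times \<open>f S\<close> must be scalar, which for
  nonscalar \<open>f S\<close> forces \<open>r = 0\<close>.\<close>

lemma f_decompose:
  assumes H: "H \<in> self_adjoints A" and K: "K \<in> self_adjoints A"
  shows "f (H + \<i> *\<^sub>C K) = f H + (\<i> * of_real (\<eta> * d)) *\<^sub>C f K"
proof -
  have "\<exists>r. f (H + \<i> *\<^sub>C K) = f H + (\<i> * of_real (\<eta> * d)) *\<^sub>C f K + r *\<^sub>C 1"
    if H: "H \<in> self_adjoints A" and K: "K \<in> self_adjoints A" for H K
  proof -
    define X where "X = H + \<i> *\<^sub>C K"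
    have X: "X \<in> A" using H K by (simp add: X_def self_adjoints_D)
    obtain R L where RL: "R \<in> self_adjoints B" "L \<in> self_adjoints B" "f X = R + \<i> *\<^sub>C L"
      using B.self_adjoints_decompose[OF f_in[OF X]] .
    have "X - adj X = (2 * \<i>) *\<^sub>C K" unfolding X_def
      by (rule diff_adj_decomposed) (use H K in \<open>auto simp: self_adjoints_D\<close>)
    then have "\<i> *\<^sub>C (X - adj X) = of_real (-2) *\<^sub>C K"
      by (simp add: scaleC_scaleC mult.left_commute[of \<i> 2])
    moreover have "f X - adj (f X) = (2 * \<i>) *\<^sub>C L"
      unfolding RL(3) by (rule diff_adj_decomposed) (use RL in \<open>auto simp: self_adjoints_def\<close>)
    ultimately have "f (of_real (-2) *\<^sub>C K) = (\<i> * of_real (\<eta> * p)) *\<^sub>C (2 * \<i>) *\<^sub>C L"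
      using f_im[OF X] by simp
    then have "of_real (-2) *\<^sub>C f K = of_real (- 2 * \<eta> * p) *\<^sub>C L"
      using K by (simp only: f_scaleR self_adjoints_D m_id) (simp add: scaleC_scaleC mult_ac)
    \<comment> \<open>As \<open>d * p = 1\<close> and \<open>\<eta>\<close> is a sign, this factor
      is the inverse of \<open>- 2 * \<eta> * p\<close>.\<close>
    then have "of_real (- \<eta> * d / 2) *\<^sub>C of_real (-2) *\<^sub>C f K = of_real (- \<eta> * d / 2) *\<^sub>C of_real (- 2 * \<eta> * p) *\<^sub>C L"
      by simp
    then have "of_real (\<eta> * d) *\<^sub>C f K = of_real ((\<eta> * \<eta>) * (d * p)) *\<^sub>C L"
      by (simp add: scaleC_scaleC mult_ac)
    then have L: "L = of_real (\<eta> * d) *\<^sub>C f K"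
      using p_nonzero by (simp add: eta_sq d_eq scaleC_one)
    have fH: "f H \<in> B" "adj (f H) = f H" using H by (simp_all add: self_adjoints_D)
    have R: "R \<in> B" "adj R = R" using RL by (simp_all add: self_adjoints_def)
    have "(R - f H) * T = T * (R - f H)" if T: "T \<in> self_adjoints B" for T
    proof -
      obtain C where C: "C \<in> self_adjoints A" "f C = T" using f_self_adjoint_surj[OF T] by blast
      have "\<i> *\<^sub>C [X, C]\<^sub>* = \<i> *\<^sub>C (H * C - C * H) + - jordan K C"
        unfolding X_def by (rule skew_lie_decomposed) (use H K in \<open>auto simp: self_adjoints_D\<close>)
      also have "f \<dots> = f (\<i> *\<^sub>C (H * C - C * H)) + f (- jordan K C)"
        by (rule additive_on_self_adjoints) (use H K C in \<open>simp_all add: A.self_adjoints_closed\<close>)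
      also have "\<dots> = (\<i> * of_real \<eta>) *\<^sub>C (f H * T - T * f H) - of_real d *\<^sub>C jordan (f K) T"
        using H K C by (simp add: f_commutator f_minus f_jordan self_adjoints_D A.self_adjoints_closed)
      finally have 1: "f (\<i> *\<^sub>C [X, C]\<^sub>*) = \<dots>" .
      have "f (\<i> *\<^sub>C [X, C]\<^sub>*) = of_real \<eta> *\<^sub>C \<i> *\<^sub>C [R + \<i> *\<^sub>C L, T]\<^sub>*"
        using f_skew_lie[OF X self_adjoints_D(1)[OF C(1)]] by (simp add: RL C scaleC_scaleC mult.commute)
      also have "\<dots> = of_real \<eta> *\<^sub>C (\<i> *\<^sub>C (R * T - T * R) + - jordan L T)"
        by (subst skew_lie_decomposed) (use RL in \<open>auto simp: self_adjoints_def\<close>)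
      also have "\<dots> = (\<i> * of_real \<eta>) *\<^sub>C (R * T - T * R) - of_real ((\<eta> * \<eta>) * d) *\<^sub>C jordan (f K) T"
        unfolding L jordan_scaleC
        by (simp add: scaleC_diff_right scaleC_scaleC mult_ac)
      finally have "(\<i> * of_real \<eta>) *\<^sub>C (R * T - T * R) = (\<i> * of_real \<eta>) *\<^sub>C (f H * T - T * f H)"
        using 1 by (simp add: eta_sq)
      then have "(\<i> * of_real \<eta>) *\<^sub>C ((R * T - T * R) - (f H * T - T * f H)) = 0"
        by (simp only: scaleC_diff_right) simp
      then have "(R * T - T * R) - (f H * T - T * f H) = 0"
        using eta_cases by (auto simp: scaleC_eq_0_iff)
      then show ?thesis by (simp add: left_diff_distrib right_diff_distrib algebra_simps)
    qed
    then obtain r where "R - f H = r *\<^sub>C 1"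
      using B.central_scalar_self_adjoints[of "R - f H"] fH R by blast
    then have "R = f H + r *\<^sub>C 1" by (simp add: algebra_simps)
    then have "f X = f H + (\<i> * of_real (\<eta> * d)) *\<^sub>C f K + r *\<^sub>C 1"
      by (simp add: RL L scaleC_scaleC add_ac)
    then show ?thesis unfolding X_def by blast
  qed
  note shifted = this
  define c where "c = \<i> * of_real (\<eta> * d)"
  obtain r where r: "f (H + \<i> *\<^sub>C K) = f H + c *\<^sub>C f K + r *\<^sub>C 1"
    using shifted[OF H K] unfolding c_def by blast
  obtain T where T: "T \<in> self_adjoints B" "\<And>z. T \<noteq> z *\<^sub>C 1" using B.nonscalar_self_adjoint by blast
  obtain S where S: "S \<in> self_adjoints A" "f S = T" using f_self_adjoint_surj[OF T(1)] by blast
  have "jordan S (H + \<i> *\<^sub>C K) = jordan S H + \<i> *\<^sub>C jordan S K"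
    by (simp add: jordan_simps jordan_scaleC)
  then obtain s where "f (jordan S (H + \<i> *\<^sub>C K)) = f (jordan S H) + c *\<^sub>C f (jordan S K) + s *\<^sub>C 1"
    using shifted[of "jordan S H" "jordan S K"] S H K A.self_adjoints_closed(5) unfolding c_def by metis
  then have "of_real d *\<^sub>C jordan T (f H + c *\<^sub>C f K + r *\<^sub>C 1) =
      of_real d *\<^sub>C jordan T (f H) + c *\<^sub>C of_real d *\<^sub>C jordan T (f K) + s *\<^sub>C 1"
    using S H K by (simp add: f_jordan self_adjoints_D r[symmetric])
  then have "of_real d *\<^sub>C r *\<^sub>C jordan T 1 = s *\<^sub>C 1"
    by (simp add: jordan_simps jordan_scaleC scaleC_add_right scaleC_scaleC mult_ac)
  then have "of_real d *\<^sub>C r *\<^sub>C 2 *\<^sub>C T = s *\<^sub>C 1" by (simp add: jordan_def scaleC_2)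
  then have eq: "(of_real d * r * 2) *\<^sub>C T = s *\<^sub>C 1" by (simp add: scaleC_scaleC mult_ac)
  have "r = 0"
  proof (rule ccontr)
    assume "r \<noteq> 0"
    then have nz: "of_real d * r * 2 \<noteq> 0" using d_nonzero by simp
    have "inverse (of_real d * r * 2) *\<^sub>C (of_real d * r * 2) *\<^sub>C T =
        inverse (of_real d * r * 2) *\<^sub>C s *\<^sub>C 1" using eq by simp
    then have "T = (inverse (of_real d * r * 2) * s) *\<^sub>C 1"
      using nz by (simp only: scaleC_scaleC left_inverse[OF nz] scaleC_one)
    then show False using T(2) by blast
  qed
  then show ?thesis using r by (simp add: c_def)
qed

text \<open>The image of a double commutator acquires the factor \<open>\<eta> * \<eta> = 1\<close>
  when computed through commutators and \<open>d * d\<close> when computed through Jordan products.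
  Since it can be chosen nonzero, \<open>d * d = 1\<close>, and \<open>d = 1 / p\<close>.\<close>

lemma p_sq: "p * p = 1"
proof -
  obtain X Y Z where XYZ: "X \<in> self_adjoints A" "Y \<in> self_adjoints A" "Z \<in> self_adjoints A"
    and nz: "(X * Y - Y * X) * Z - Z * (X * Y - Y * X) \<noteq> 0"
    using A.nonvanishing_double_commutator by blast
  have comm: "\<i> *\<^sub>C (X * Y - Y * X) \<in> self_adjoints A" using XYZ by (simp add: A.self_adjoints_closed)
  have dc_in: "double_commutator X Y Z \<in> self_adjoints A"
    using A.self_adjoints_closed(8)[OF comm XYZ(3)] unfolding iterated_ii_commutator
    by (metis A.self_adjoints_closed(6) minus_minus)
  have "- f (double_commutator X Y Z) = f (\<i> *\<^sub>C ((\<i> *\<^sub>C (X * Y - Y * X)) * Z - Z * (\<i> *\<^sub>C (X * Y - Y * X))))"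
    unfolding iterated_ii_commutator using f_minus dc_in self_adjoints_D by simp
  also have "\<dots> = (\<i> * of_real \<eta>) *\<^sub>C (((\<i> * of_real \<eta>) *\<^sub>C (f X * f Y - f Y * f X)) * f Z -
      f Z * ((\<i> * of_real \<eta>) *\<^sub>C (f X * f Y - f Y * f X)))"
    by (simp only: f_commutator comm XYZ)
  also have "\<dots> = (\<i> * of_real \<eta> * (\<i> * of_real \<eta>)) *\<^sub>C double_commutator (f X) (f Y) (f Z)"
    by (simp only: double_commutator_def scaleC_mult_left scaleC_mult_right scaleC_diff_right[symmetric] scaleC_scaleC)
  also have "\<i> * of_real \<eta> * (\<i> * of_real \<eta>) = - of_real (\<eta> * \<eta>)" by (simp add: mult_ac)
  finally have 1: "f (double_commutator X Y Z) = double_commutator (f X) (f Y) (f Z)" by (simp add: eta_sq scaleC_minus1_left)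
  have "f (jordan X (jordan Y Z)) = f (jordan Y (jordan X Z)) + f (double_commutator X Y Z)"
    unfolding jordan_jordan_left_commute[of X Y Z] using XYZ dc_in
    by (intro additive_on_self_adjoints A.self_adjoints_closed)
  then have "f (double_commutator X Y Z) = (of_real d * of_real d) *\<^sub>C
      (jordan (f X) (jordan (f Y) (f Z)) - jordan (f Y) (jordan (f X) (f Z)))"
    using XYZ by (simp add: jordan A.self_adjoints_closed jordan_scaleC scaleC_scaleC scaleC_diff_right)
  also have "\<dots> = of_real (d * d) *\<^sub>C double_commutator (f X) (f Y) (f Z)" by (simp add: jordan_jordan_left_commute[of "f X"])
  finally have "of_real (1 - d * d) *\<^sub>C f (double_commutator X Y Z) = 0"
    unfolding 1 using scaleC_add_left[of "of_real (1 - d * d)" "of_real (d * d)" "double_commutator (f X) (f Y) (f Z)"]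
    by (simp add: scaleC_one)
  moreover have "f (double_commutator X Y Z) \<noteq> 0" using nz dc_in by (simp add: f_eq_0_iff self_adjoints_D double_commutator_def)
  ultimately have "complex_of_real (1 - d * d) = 0" by (simp only: scaleC_eq_0_iff) simp
  then have "d * d = 1" by (simp only: of_real_eq_0_iff)
  then show ?thesis using p_nonzero by (simp add: d_eq field_simps)
qed

section \<open>The complex structure and multiplicativity\<close>

lemma d_eq_p: "d = p"
  using p_sq p_nonzero by (simp add: d_eq field_simps)

text \<open>The factor that \<open>f_decompose\<close> attaches to imaginary parts, rewritten with
  \<open>d = p\<close>.\<close>

definition \<theta> :: complex where "\<theta> = \<i> * of_real (\<eta> * p)"

lemma theta_sq: "\<theta> * \<theta> = -1"
proof -
  have "\<theta> * \<theta> = - of_real ((\<eta> * \<eta>) * (p * p))" by (simp add: \<theta>_def mult_ac)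
  then show ?thesis by (simp add: eta_sq p_sq)
qed

lemma cnj_theta: "cnj \<theta> = - \<theta>"
  by (simp add: \<theta>_def)

lemma f_theta:
  "H \<in> self_adjoints A \<Longrightarrow> K \<in> self_adjoints A \<Longrightarrow> f (H + \<i> *\<^sub>C K) = f H + \<theta> *\<^sub>C f K"
  using f_decompose by (simp add: d_eq_p \<theta>_def)

lemma f_add:
  assumes "X \<in> A" "Y \<in> A"
  shows "f (X + Y) = f X + f Y"
proof -
  obtain H K where 1: "H \<in> self_adjoints A" "K \<in> self_adjoints A" "X = H + \<i> *\<^sub>C K"
    using A.self_adjoints_decompose[OF assms(1)] .
  obtain H' K' where 2: "H' \<in> self_adjoints A" "K' \<in> self_adjoints A" "Y = H' + \<i> *\<^sub>C K'"
    using A.self_adjoints_decompose[OF assms(2)] .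
  have "X + Y = (H + H') + \<i> *\<^sub>C (K + K')" by (simp add: 1 2 scaleC_add_right add_ac)
  then have "f (X + Y) = f (H + H') + \<theta> *\<^sub>C f (K + K')"
    using f_theta[of "H + H'" "K + K'"] 1(1,2) 2(1,2) by (simp add: A.self_adjoints_closed)
  then show ?thesis
    using 1 2 by (simp add: f_theta additive_on_self_adjoints scaleC_add_right add_ac)
qed

lemma f_ii:
  assumes "X \<in> A"
  shows "f (\<i> *\<^sub>C X) = \<theta> *\<^sub>C f X"
proof -
  obtain H K where 1: "H \<in> self_adjoints A" "K \<in> self_adjoints A" "X = H + \<i> *\<^sub>C K"
    using A.self_adjoints_decompose[OF assms] .
  have "\<i> *\<^sub>C X = - K + \<i> *\<^sub>C H"
    by (simp add: 1 scaleC_add_right scaleC_scaleC scaleC_minus1_left add.commute)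
  then have "f (\<i> *\<^sub>C X) = - f K + \<theta> *\<^sub>C f H"
    using f_theta[of "- K" H] 1(1,2) by (simp add: A.self_adjoints_closed f_minus self_adjoints_D)
  then show ?thesis
    using 1 by (simp add: f_theta scaleC_add_right scaleC_scaleC theta_sq scaleC_minus1_left)
qed

lemma f_scaleC:
  assumes X: "X \<in> A"
  shows "f (c *\<^sub>C X) = (of_real (Re c) + \<theta> * of_real (Im c)) *\<^sub>C f X"
proof -
  have "c *\<^sub>C X = of_real (Re c) *\<^sub>C X + \<i> *\<^sub>C of_real (Im c) *\<^sub>C X"
    by (simp only: scaleC_scaleC scaleC_add_left[symmetric] complex_eq[symmetric])
  then have "f (c *\<^sub>C X) = f (of_real (Re c) *\<^sub>C X) + f (\<i> *\<^sub>C of_real (Im c) *\<^sub>C X)"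
    using X by (simp only: f_add A.scaleC_in)
  then show ?thesis
    using X by (simp add: f_ii f_scaleR m_id) (simp add: scaleC_scaleC scaleC_add_left)
qed

lemma f_adj:
  assumes "X \<in> A"
  shows "f (adj X) = adj (f X)"
proof -
  obtain H K where 1: "H \<in> self_adjoints A" "K \<in> self_adjoints A" "X = H + \<i> *\<^sub>C K"
    using A.self_adjoints_decompose[OF assms] .
  have "adj X = H + \<i> *\<^sub>C (- K)"
    using 1 by (simp add: adj_add adj_scaleC self_adjoints_D scaleC_minus_left scaleC_minus_right)
  then have "f (adj X) = f H + \<theta> *\<^sub>C (- f K)"
    using f_theta[of H "- K"] 1(1,2) by (simp add: A.self_adjoints_closed f_minus self_adjoints_D)
  then show ?thesis
    using 1 by (simp add: f_theta adj_add adj_scaleC self_adjoints_D cnj_theta scaleC_minus_left scaleC_minus_right)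
qed

text \<open>Twice \<open>X * Y\<close> is a Jordan product plus the commutator \<open>D\<close>. The
  formula for commutators concerns \<open>\<i> D\<close>, so \<open>\<theta>\<close> has to be
  cancelled; since \<open>\<i> * \<eta> = \<theta> * p\<close>, the factor left over is
  \<open>p\<close>, the same as for the Jordan product.\<close>

lemma f_mult_self_adjoint:
  assumes X: "X \<in> self_adjoints A" and Y: "Y \<in> self_adjoints A"
  shows "f (X * Y) = of_real p *\<^sub>C (f X * f Y)"
proof -
  define D where "D = X * Y - Y * X"
  have X_in: "X \<in> A" "Y \<in> A" "D \<in> A" using X Y by (simp_all add: self_adjoints_D D_def)
  have "of_real 2 *\<^sub>C (X * Y) = jordan X Y + D" by (simp add: jordan_def D_def scaleC_2)
  then have "f (of_real 2 *\<^sub>C (X * Y)) = f (jordan X Y) + f D"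
    using X_in by (simp only: f_add jordan_def A.add_in A.mult_in)
  then have 1: "of_real 2 *\<^sub>C f (X * Y) = f (jordan X Y) + f D"
    using X_in by (simp only: f_scaleR m_id A.mult_in)
  have "\<theta> *\<^sub>C f D = \<theta> *\<^sub>C of_real p *\<^sub>C (f X * f Y - f Y * f X)"
    using f_ii[OF X_in(3)] f_commutator[OF X Y] p_sq
    by (simp add: D_def \<theta>_def scaleC_scaleC mult_ac flip: of_real_mult)
  then have "\<theta> *\<^sub>C (f D - of_real p *\<^sub>C (f X * f Y - f Y * f X)) = 0" by (simp add: scaleC_diff_right)
  moreover have "\<theta> \<noteq> 0" using theta_sq by auto
  ultimately have 2: "f D = of_real p *\<^sub>C (f X * f Y - f Y * f X)" by (simp add: scaleC_eq_0_iff)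
  have "of_real 2 *\<^sub>C f (X * Y) = of_real p *\<^sub>C (jordan (f X) (f Y) + (f X * f Y - f Y * f X))"
    unfolding 1 2 by (simp only: jordan[OF X Y] d_eq_p scaleC_add_right)
  also have "\<dots> = of_real p *\<^sub>C (f X * f Y + f X * f Y)" by (simp add: jordan_def)
  finally have "f (X * Y) + f (X * Y) = of_real p *\<^sub>C (f X * f Y) + of_real p *\<^sub>C (f X * f Y)"
    by (simp add: scaleC_2 scaleC_add_right)
  then show ?thesis unfolding double_inject .
qed

lemma f_mult:
  assumes "X \<in> A" "Y \<in> A"
  shows "f (X * Y) = of_real p *\<^sub>C (f X * f Y)"
proof -
  obtain H K where 1: "H \<in> self_adjoints A" "K \<in> self_adjoints A" "X = H + \<i> *\<^sub>C K"
    using A.self_adjoints_decompose[OF assms(1)] .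
  obtain H' K' where 2: "H' \<in> self_adjoints A" "K' \<in> self_adjoints A" "Y = H' + \<i> *\<^sub>C K'"
    using A.self_adjoints_decompose[OF assms(2)] .
  note in_A = 1(1,2)[THEN self_adjoints_D(1)] 2(1,2)[THEN self_adjoints_D(1)]
  show ?thesis using in_A
    by (simp add: 1(3) 2(3) distrib_left distrib_right scaleC_mult_left scaleC_mult_right
        f_add f_ii f_mult_self_adjoint 1(1,2) 2(1,2) scaleC_add_right)
      (simp add: scaleC_scaleC mult_ac)
qed

end

text \<open>The sign is \<open>p\<close>, where \<open>\<phi> 1 = p\<close>; \<open>\<phi>\<close> is linear or conjugate linear according to the value
  \<open>\<theta> = \<plusminus> \<i>\<close> in \<open>\<phi> (\<i> X) = \<theta> \<phi> X\<close>.\<close>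

theorem theorem2p1:
  fixes A :: "'h::complex_hilbert bop set"
    and B :: "'k::complex_hilbert bop set"
    and \<phi> :: "'h bop \<Rightarrow> 'k bop"
  assumes "factor A" and "factor B"
    and "\<not> A \<subseteq> scalar_operators"
    and "bij_betw \<phi> A B"
    and "\<And>X Y Z. X \<in> A \<Longrightarrow> Y \<in> A \<Longrightarrow> Z \<in> A \<Longrightarrow>
           \<phi> ([X, Y]\<^sub>* \<bullet>\<^sub>* Z) = [\<phi> X, \<phi> Y]\<^sub>* \<bullet>\<^sub>* \<phi> Z"
  shows "linear_star_isomorphism A B \<phi> \<or>
         conj_linear_star_isomorphism A B \<phi> \<or>
         (\<exists>\<psi>. linear_star_isomorphism A B \<psi> \<and> (\<forall>T\<in>A. \<phi> T = - \<psi> T)) \<or>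
         (\<exists>\<psi>. conj_linear_star_isomorphism A B \<psi> \<and> (\<forall>T\<in>A. \<phi> T = - \<psi> T))"
proof -
  have A: "nonscalar_factor A" using assms by unfold_locales
  have B: "nonscalar_factor B"
    using assms(2) mixed_codomain_nonscalar[OF A assms(4,5)] by unfold_locales
  interpret mixed_map A B \<phi>
    using A B assms(4,5) by (simp add: mixed_map_def mixed_map_axioms_def)
  \<comment> \<open>The factor \<open>p\<close> from \<open>f_mult\<close> and the one in
    \<open>\<psi>\<close> are shared out between the two images, so \<open>\<psi>\<close> is
    multiplicative; \<open>p * p = 1\<close> makes the scaling a bijection of
    \<open>B\<close>.\<close>
  define \<psi> where "\<psi> X = of_real p *\<^sub>C \<phi> X" for X
  have p: "p = 1 \<or> p = -1" using p_sq by (simp add: power2_eq_1_iff flip: power2_eq_square)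
  have \<theta>: "\<theta> = \<i> \<or> \<theta> = - \<i>" using p eta_cases by (auto simp: \<theta>_def)
  have invol: "of_real p *\<^sub>C of_real p *\<^sub>C Z = Z" for Z :: "'k bop"
    by (simp add: scaleC_scaleC p_sq scaleC_one flip: of_real_mult)
  have "bij_betw ((*\<^sub>C) (of_real p)) B B"
    by (rule bij_betw_byWitness[where f' = "(*\<^sub>C) (of_real p)"]) (auto simp: invol)
  then have "bij_betw \<psi> A B"
    using bij_betw_trans[OF assms(4)] by (simp add: \<psi>_def[abs_def] comp_def)
  moreover have "\<psi> (X + Y) = \<psi> X + \<psi> Y" if "X \<in> A" "Y \<in> A" for X Y
    using that by (simp add: \<psi>_def f_add scaleC_add_right)
  moreover have "\<psi> (X * Y) = \<psi> X * \<psi> Y" if "X \<in> A" "Y \<in> A" for X Y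
    using that by (simp add: \<psi>_def f_mult scaleC_mult_left scaleC_mult_right)
  moreover have "\<psi> (adj X) = adj (\<psi> X)" if "X \<in> A" for X
    using that by (simp add: \<psi>_def f_adj adj_scaleC)
  moreover have "\<psi> (c *\<^sub>C X) = (of_real (Re c) + \<theta> * of_real (Im c)) *\<^sub>C \<psi> X" if "X \<in> A" for c X
    using that by (simp add: \<psi>_def f_scaleC scaleC_scaleC mult_ac)
  then have "(\<forall>c. \<forall>X\<in>A. \<psi> (c *\<^sub>C X) = c *\<^sub>C \<psi> X) \<or> (\<forall>c. \<forall>X\<in>A. \<psi> (c *\<^sub>C X) = cnj c *\<^sub>C \<psi> X)"
  proof (cases "\<theta> = \<i>")
    case False
    then have "\<theta> = - \<i>" using \<theta> by blast
    then have "of_real (Re c) + \<theta> * of_real (Im c) = cnj c" for c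
      by (simp add: complex_eq_iff)
    with \<open>\<And>c X. X \<in> A \<Longrightarrow> \<psi> (c *\<^sub>C X) = _\<close> show ?thesis by simp
  qed (simp add: complex_eq[symmetric])
  ultimately have iso: "linear_star_isomorphism A B \<psi> \<or> conj_linear_star_isomorphism A B \<psi>"
    unfolding linear_star_isomorphism_def conj_linear_star_isomorphism_def by blast
  from p show ?thesis
  proof
    assume "p = 1"
    then have "\<psi> = \<phi>" by (simp add: \<psi>_def[abs_def] scaleC_one)
    then show ?thesis using iso by blast
  next
    assume "p = -1"
    then have "\<phi> T = - \<psi> T" for T by (simp add: \<psi>_def scaleC_minus1_left)
    then show ?thesis using iso by blast
  qed
qed

end
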